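(* (a) There is an absolute constant $K>0$ such that for all integers $d\ge 1$, $k\ge 2$ and every POVM $\mathbf{M}=(M_1,\dots,M_n)$ on $\mathbb{C}^d$, there exist a probability distribution $\{p_\beta\}$ and POVMs $\mathbf{N}^{(\beta)}$ on $\mathbb{C}^d$ with outcome set $[n]\cup\{\emptyset\}$ such that each $\mathbf{N}^{(\beta)}$ is implementable with a $k$-dimensional ancilla, and $\sum_\beta p_\beta \mathbf{N}^{(\beta)}=(q_k\mathbf{M},(1-q_k)\mathbb{I}_d)$ for some $q_k\ge 1-K k^{-1/2}$. (b) For $k=2$ one can moreover achieve $q_2\ge 1/8$ with each $\mathbf{N}^{(\beta)}$ implementable with a $2$-dimensional ancilla (a single qubit) and having at most $d+1$ nonzero effects.
   Context: A POVM on $\mathbb{C}^d$ with $n$ outcomes is a tuple $(M_1,\dots,M_n)$ of positive semidefinite operators summing to $\mathbb{I}_d$; it is projective if its effects satisfy $M_iM_j=\delta_{ij}M_i$. A classical post-processing is given by numbers $q_{i|j}\ge0$ with $\sum_i q_{i|j}=1$, mapping effects $M_j$ to $\sum_j q_{i|j}M_j$. Convex combinations of POVMs are taken effect-wise. The notation $(q\mathbf{M},(1-q)\mathbb{I}_d)$ denotes the POVM with outcome set $[n]\cup\{\emptyset\}$ and effects $qM_i$ for $i\in[n]$ and $(1-q)\mathbb{I}_d$ for $\emptyset$ (i.e., simulation of $\mathbf{M}$ with postselection probability $q$). A POVM $\mathbf{N}$ on $\mathbb{C}^d$ is implementable with a $k$-dimensional ancilla if there exist a unit vector $\ket{\phi_0}\in\mathbb{C}^k$,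 a projective measurement $(P_1,\dots,P_m)$ on $\mathbb{C}^d\otimes\mathbb{C}^k$ and a classical post-processing $q_{i|j}$ such that $N_i=\sum_j q_{i|j}(\mathbb{I}_d\otimes\bra{\phi_0})P_j(\mathbb{I}_d\otimes\ket{\phi_0})$ for all outcomes $i$. *)

theory Defs
  imports Complex_Main "Jordan_Normal_Form.Matrix"
begin

definition msum :: "nat \<Rightarrow> ('i \<Rightarrow> complex mat) \<Rightarrow> 'i set \<Rightarrow> complex mat" where
  "msum d f I = mat d d (\<lambda>(a,b). \<Sum>i\<in>I. f i $$ (a,b))"

definition adj :: "complex mat \<Rightarrow> complex mat" where
  "adj A = mat (dim_col A) (dim_row A) (\<lambda>(i,j). cnj (A $$ (j,i)))"

definition psd :: "nat \<Rightarrow> complex mat \<Rightarrow> bool" where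
  "psd d A \<longleftrightarrow> A \<in> carrier_mat d d \<and>
     (\<forall>v \<in> carrier_vec d. Im ((A *\<^sub>v v) \<bullet>c v) = 0 \<and> Re ((A *\<^sub>v v) \<bullet>c v) \<ge> 0)"

definition povm :: "nat \<Rightarrow> nat \<Rightarrow> (nat \<Rightarrow> complex mat) \<Rightarrow> bool" where
  "povm d n M \<longleftrightarrow> (\<forall>i<n. psd d (M i)) \<and> msum d M {..<n} = 1\<^sub>m d"

definition projective :: "nat \<Rightarrow> nat \<Rightarrow> (nat \<Rightarrow> complex mat) \<Rightarrow> bool" where
  "projective d n P \<longleftrightarrow> povm d n P \<and>
     (\<forall>i<n. \<forall>j<n. P i * P j = (if i = j then P i else 0\<^sub>m d d))"

text \<open>The isometry I_d tensor |phi> from C^d to C^d (x) C^k, with the basis vector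
  e_a (x) e_b of C^d (x) C^k indexed by a*k+b.\<close>
definition embed :: "nat \<Rightarrow> nat \<Rightarrow> complex vec \<Rightarrow> complex mat" where
  "embed d k \<phi> = mat (d * k) d (\<lambda>(r,c). if r div k = c then \<phi> $ (r mod k) else 0)"

definition implementable :: "nat \<Rightarrow> nat \<Rightarrow> nat \<Rightarrow> (nat \<Rightarrow> complex mat) \<Rightarrow> bool" where
  "implementable d k nout N \<longleftrightarrow>
     (\<exists>\<phi> m P q.
        \<phi> \<in> carrier_vec k \<and> \<phi> \<bullet>c \<phi> = 1 \<and>
        projective (d * k) m P \<and>
        (\<forall>i<nout. \<forall>j<m. q i j \<ge> (0::real)) \<and>
        (\<forall>j<m. (\<Sum>i<nout. q i j) = 1) \<and>
        (\<forall>i<nout. N i = msum d (\<lambda>j. complex_of_real (q i j) \<cdot>\<^sub>m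
                          (adj (embed d k \<phi>) * P j * embed d k \<phi>)) {..<m}))"

text \<open>(q M, (1-q) I_d) with outcome set {0..<n} \<union> {empty}, empty encoded as outcome n.\<close>
definition postsel :: "nat \<Rightarrow> nat \<Rightarrow> real \<Rightarrow> (nat \<Rightarrow> complex mat) \<Rightarrow> nat \<Rightarrow> complex mat" where
  "postsel d n q M i = (if i < n then complex_of_real q \<cdot>\<^sub>m M i
                        else complex_of_real (1 - q) \<cdot>\<^sub>m 1\<^sub>m d)"

definition prob_dist :: "nat \<Rightarrow> (nat \<Rightarrow> real) \<Rightarrow> bool" where
  "prob_dist r p \<longleftrightarrow> (\<forall>b<r. p b \<ge> 0) \<and> (\<Sum>b<r. p b) = 1"

end

theory Submission
  imports Defs "Jordan_Normal_Form.Determinant"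
begin

text \<open>
  Split the effects of the POVM into rank-one pieces \<open>V\<^sub>j V\<^sub>j\<^sup>*\<close> summing to the identity.
  A randomised, one-sided version of the Batson-Spielman-Srivastava barrier walk replaces the
  Kadison-Singer theorem. The state is \<open>B = u - A\<close>, where \<open>A\<close> is the weighted sum of the pieces
  chosen so far, and the potential \<open>tr B\<^sup>-\<^sup>1\<close> never increases. In each step \<open>u\<close> grows by \<open>\<delta>\<close>;
  with \<open>Y = (B + \<delta>)\<^sup>-\<^sup>1\<close> and \<open>U\<^sub>j = V\<^sub>j\<^sup>* Y\<^sup>2 V\<^sub>j / (\<delta> tr Y\<^sup>2) + V\<^sub>j\<^sup>* Y V\<^sub>j\<close>, piece \<open>j\<close> may be
  added with weight \<open>1 / U\<^sub>j\<close>, and the \<open>U\<^sub>j\<close> sum to at most \<open>C = 1 / \<delta> + \<epsilon>\<close>. Hence choosing \<open>j\<close>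
  with probability \<open>U\<^sub>j / C\<close> raises the expected weight of every piece by exactly \<open>1 / C\<close>, while
  every run keeps \<open>A \<le> u\<close>. After \<open>d (k - 1)\<close> steps with \<open>\<delta> = 1 / sqrt (k - 1)\<close>, started at
  \<open>u = d\<close>, this gives \<open>q = (k - 1) / (1 + sqrt (k - 1))\<^sup>2\<close>.

  A run selects at most \<open>d (k - 1)\<close> rank-one effects with sum \<open>W W\<^sup>* \<le> 1\<close>. Factoring \<open>1 - W\<^sup>* W\<close>
  completes \<open>W\<close> to an isometry into dimension \<open>d k\<close>, whose columns and their orthogonal
  complement form the projective measurement.
\<close>

section \<open>Positive semidefinite matrices and traces\<close>

definition tr :: "complex mat \<Rightarrow> complex" where
  "tr A = (\<Sum>i<dim_row A. A $$ (i,i))"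

section \<open>Adjoints, matrix products and quadratic forms\<close>

lemma adj_carrier [simp]: "A \<in> carrier_mat m n \<Longrightarrow> adj A \<in> carrier_mat n m"
  by (simp add: adj_def)

lemma dim_adj [simp]: "dim_row (adj A) = dim_col A" "dim_col (adj A) = dim_row A"
  by (simp_all add: adj_def)

lemma index_adj [simp]:
  "i < dim_col A \<Longrightarrow> j < dim_row A \<Longrightarrow> adj A $$ (i,j) = cnj (A $$ (j,i))"
  by (simp add: adj_def)

lemma adj_adj [simp]: "adj (adj A) = A"
  by (rule eq_matI) auto

lemma index_mult_sum:
  "A \<in> carrier_mat l m \<Longrightarrow> B \<in> carrier_mat m n \<Longrightarrow> i < l \<Longrightarrow> j < n \<Longrightarrow>
    (A * B) $$ (i,j) = (\<Sum>k<m. A $$ (i,k) * B $$ (k,j))"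
  by (simp add: scalar_prod_def atLeast0LessThan)

lemma adj_mult:
  assumes "A \<in> carrier_mat l m" "B \<in> carrier_mat m n"
  shows "adj (A * B) = adj B * adj A"
  using assms by (intro eq_matI) (auto simp: scalar_prod_def intro!: sum.cong)

lemma adj_one [simp]: "adj (1\<^sub>m d) = 1\<^sub>m d"
  by (rule eq_matI) auto

lemma adj_minus:
  "A \<in> carrier_mat m n \<Longrightarrow> B \<in> carrier_mat m n \<Longrightarrow> adj (A - B) = adj A - adj B"
  by (rule eq_matI) auto

lemma adj_smult [simp]: "adj (c \<cdot>\<^sub>m A) = cnj c \<cdot>\<^sub>m adj A"
  by (rule eq_matI) auto

lemma cscalar_prod_adj:
  assumes "A \<in> carrier_mat m n" "v \<in> carrier_vec n" "w \<in> carrier_vec m"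
  shows "(A *\<^sub>v v) \<bullet>c w = v \<bullet>c (adj A *\<^sub>v w)"
proof -
  have "(A *\<^sub>v v) \<bullet>c w = (\<Sum>i<m. \<Sum>j<n. A $$ (i,j) * v $ j * cnj (w $ i))"
    using assms by (simp add: scalar_prod_def atLeast0LessThan sum_distrib_right)
  also have "\<dots> = (\<Sum>j<n. \<Sum>i<m. A $$ (i,j) * v $ j * cnj (w $ i))"
    by (rule sum.swap)
  also have "\<dots> = v \<bullet>c (adj A *\<^sub>v w)"
    using assms by (simp add: scalar_prod_def atLeast0LessThan sum_distrib_left mult_ac)
  finally show ?thesis .
qed

lemma cscalar_prod_conv_sum:
  "v \<in> carrier_vec n \<Longrightarrow> w \<in> carrier_vec n \<Longrightarrow> v \<bullet>c w = (\<Sum>i<n. v $ i * cnj (w $ i))"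
  by (simp add: scalar_prod_def atLeast0LessThan)

lemma cscalar_prod_self:
  "v \<in> carrier_vec n \<Longrightarrow> v \<bullet>c v = complex_of_real (\<Sum>i<n. (cmod (v $ i))\<^sup>2)"
  unfolding of_real_sum complex_norm_square by (simp add: cscalar_prod_conv_sum)

lemma quadratic_form_sum:
  assumes "A \<in> carrier_mat n n" "v \<in> carrier_vec n"
  shows "(A *\<^sub>v v) \<bullet>c v = (\<Sum>i<n. \<Sum>j<n. A $$ (i,j) * v $ j * cnj (v $ i))"
  using assms by (simp add: scalar_prod_def atLeast0LessThan sum_distrib_right)

lemma psd_carrier: "psd d A \<Longrightarrow> A \<in> carrier_mat d d"
  by (simp add: psd_def)

section \<open>Closure properties of the positive semidefinite cone\<close>

lemma psd_one: "psd d (1\<^sub>m d)"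
  by (auto simp: psd_def cscalar_prod_self simp del: of_real_sum intro!: sum_nonneg)

text \<open>Moving \<open>C\<close> across the inner product turns the form at \<open>v\<close> into
  the form of \<open>A\<close> at \<open>C *\<^sub>v v\<close>. Nearly every positivity claim below
  is reduced to this.\<close>

lemma psd_congruence:
  assumes A: "psd m A" and C: "C \<in> carrier_mat m n"
  shows "psd n (adj C * A * C)"
proof -
  have A': "A \<in> carrier_mat m m" using A by (rule psd_carrier)
  have "((adj C * A * C) *\<^sub>v v) \<bullet>c v = (A *\<^sub>v (C *\<^sub>v v)) \<bullet>c (C *\<^sub>v v)" if v: "v \<in> carrier_vec n" for v
  proof -
    have "(adj C * A * C) *\<^sub>v v = adj C *\<^sub>v (A *\<^sub>v (C *\<^sub>v v))"
      using A' C v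
      by (subst assoc_mult_mat_vec[of _ n m _ n], auto simp: assoc_mult_mat_vec[of _ n m _ m])
    thus ?thesis
      using cscalar_prod_adj[of "adj C" n m "A *\<^sub>v (C *\<^sub>v v)" v] A' C v by simp
  qed
  thus ?thesis using A A' C unfolding psd_def
    by (auto intro!: mult_carrier_mat[of _ _ m])
qed

lemma psd_gram: "C \<in> carrier_mat m n \<Longrightarrow> psd n (adj C * C)"
  using psd_congruence[OF psd_one, of C m n] by simp

lemma psd_gram': "C \<in> carrier_mat m n \<Longrightarrow> psd m (C * adj C)"
  using psd_gram[of "adj C" n m] by simp

lemma psd_smult:
  assumes "psd d A" "0 \<le> c"
  shows "psd d (complex_of_real c \<cdot>\<^sub>m A)"
proof -
  have "((complex_of_real c \<cdot>\<^sub>m A) *\<^sub>v v) \<bullet>c v = complex_of_real c * ((A *\<^sub>v v) \<bullet>c v)"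
    if "v \<in> carrier_vec d" for v
    using assms(1) that
    by (subst (1 2) quadratic_form_sum[of _ d])
       (auto simp: psd_def sum_distrib_left mult_ac intro!: sum.cong)
  thus ?thesis using assms by (auto simp: psd_def)
qed

lemma psd_add:
  assumes "psd d A" "psd d B"
  shows "psd d (A + B)"
proof -
  have "((A + B) *\<^sub>v v) \<bullet>c v = (A *\<^sub>v v) \<bullet>c v + (B *\<^sub>v v) \<bullet>c v"
    if "v \<in> carrier_vec d" for v
    using assms that
    by (subst (1 2 3) quadratic_form_sum[of _ d])
       (auto simp: psd_def algebra_simps sum.distrib[symmetric] intro!: sum.cong)
  thus ?thesis using assms by (auto simp: psd_def)
qed

lemma psd_zero: "psd d (0\<^sub>m d d)"
proof -
  have "complex_of_real 0 \<cdot>\<^sub>m 1\<^sub>m d = 0\<^sub>m d d" by (rule eq_matI) auto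
  thus ?thesis using psd_smult[OF psd_one, of 0 d] by simp
qed

lemma msum_carrier [simp]: "msum d f I \<in> carrier_mat d d"
  by (simp add: msum_def)

lemma dim_msum [simp]: "dim_row (msum d f I) = d" "dim_col (msum d f I) = d"
  by (simp_all add: msum_def)

lemma index_msum [simp]: "a < d \<Longrightarrow> b < d \<Longrightarrow> msum d f I $$ (a,b) = (\<Sum>i\<in>I. f i $$ (a,b))"
  by (simp add: msum_def)

lemma msum_insert:
  "finite I \<Longrightarrow> i \<notin> I \<Longrightarrow> f i \<in> carrier_mat d d \<Longrightarrow> msum d f (insert i I) = f i + msum d f I"
  by (rule eq_matI) auto

lemma msum_empty [simp]: "msum d f {} = 0\<^sub>m d d"
  by (rule eq_matI) auto

lemma psd_msum: "(\<And>i. i \<in> I \<Longrightarrow> psd d (f i)) \<Longrightarrow> psd d (msum d f I)"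
proof (induction I rule: infinite_finite_induct)
  \<comment> \<open>Sums over infinite sets are 0, so \<open>msum\<close> is the zero matrix and no
    finiteness assumption is needed.\<close>
  case (infinite I)
  hence "msum d f I = 0\<^sub>m d d" by (intro eq_matI) auto
  thus ?case by (simp add: psd_zero)
next
  case (insert i I)
  thus ?case by (auto simp: msum_insert psd_carrier intro!: psd_add)
qed (simp add: psd_zero)

lemma psd_diag:
  assumes "psd d A" "i < d"
  shows "Im (A $$ (i,i)) = 0" "Re (A $$ (i,i)) \<ge> 0"
proof -
  have A: "A \<in> carrier_mat d d" using assms by (simp add: psd_carrier)
  have "(A *\<^sub>v unit_vec d i) \<bullet>c unit_vec d i = A $$ (i,i)"
    using A assms(2) by (simp add: cscalar_prod_conv_sum[of _ d] scalar_prod_def unit_vec_def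
       if_distrib if_distribR sum.If_cases cong: if_cong)
  thus "Im (A $$ (i,i)) = 0" "Re (A $$ (i,i)) \<ge> 0"
    using assms(1) unit_vec_carrier[of d i] unfolding psd_def by metis+
qed

text \<open>Complex polarization: \<open>psd\<close> only asks for real nonnegative values of the
  quadratic form. Testing it on \<open>e_i + c e_j\<close> with \<open>c = 1\<close> shows that the
  imaginary parts of the entries \<open>(i,j)\<close> and \<open>(j,i)\<close> cancel, and
  \<open>c = \<i>\<close> shows that their real parts agree.\<close>

lemma psd_hermitian:
  assumes "psd d A"
  shows "adj A = A"
proof -
  have A: "A \<in> carrier_mat d d" using assms by (rule psd_carrier)
  have "A $$ (i,j) = cnj (A $$ (j,i))" if ij: "i < d" "j < d" for i j
  proof -
    have im: "Im (\<Sum>a<d. \<Sum>b<d. A $$ (a,b) * f b * cnj (f a)) = 0" for f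
    proof -
      have "(A *\<^sub>v vec d f) \<bullet>c vec d f = (\<Sum>a<d. \<Sum>b<d. A $$ (a,b) * f b * cnj (f a))"
        using quadratic_form_sum[OF A, of "vec d f"] by simp
      moreover have "Im ((A *\<^sub>v vec d f) \<bullet>c vec d f) = 0"
        using assms by (simp add: psd_def)
      ultimately show ?thesis by simp
    qed
    note diag = psd_diag(1)[OF assms]
    show ?thesis
    proof (cases "i = j")
      case True
      thus ?thesis using diag[OF ij(1)] by (simp add: complex_eq_iff)
    next
      case False
      have pol: "(\<Sum>a<d. \<Sum>b<d. A $$ (a,b) * (if b = i then 1 else if b = j then c else 0)
            * cnj (if a = i then 1 else if a = j then c else 0))
         = A $$ (i,i) + c * A $$ (i,j) + cnj c * A $$ (j,i) + c * cnj c * A $$ (j,j)" for c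
      proof -
        have "(\<Sum>b<d. A $$ (a,b) * (if b = i then 1 else if b = j then c else 0))
            = A $$ (a,i) + c * A $$ (a,j)" for a
        proof -
          have "(\<Sum>b<d. A $$ (a,b) * (if b = i then 1 else if b = j then c else 0))
              = (\<Sum>b<d. (if b = i then A $$ (a,b) else 0) + (if b = j then c * A $$ (a,b) else 0))"
            using False by (intro sum.cong) auto
          thus ?thesis using ij by (simp add: sum.distrib)
        qed
        hence "(\<Sum>a<d. \<Sum>b<d. A $$ (a,b) * (if b = i then 1 else if b = j then c else 0)
            * cnj (if a = i then 1 else if a = j then c else 0))
          = (\<Sum>a<d. (A $$ (a,i) + c * A $$ (a,j)) * cnj (if a = i then 1 else if a = j then c else 0))"
          by (simp add: sum_distrib_right[symmetric])
        also have "\<dots> = (\<Sum>a<d. (if a = i then A $$ (a,i) + c * A $$ (a,j) else 0)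
             + (if a = j then (A $$ (a,i) + c * A $$ (a,j)) * cnj c else 0))"
          using False by (intro sum.cong) auto
        finally show ?thesis using ij by (simp add: sum.distrib algebra_simps)
      qed
      have "Im (A $$ (i,j)) + Im (A $$ (j,i)) = 0"
        using im[of "\<lambda>b. if b = i then 1 else if b = j then 1 else 0", unfolded pol]
          diag[OF ij(1)] diag[OF ij(2)] by simp
      moreover have "Re (A $$ (i,j)) - Re (A $$ (j,i)) = 0"
        using im[of "\<lambda>b. if b = i then 1 else if b = j then \<i> else 0", unfolded pol]
          diag[OF ij(1)] diag[OF ij(2)] by simp
      ultimately show ?thesis by (simp add: complex_eq_iff)
    qed
  qed
  hence "adj A $$ (i,j) = A $$ (i,j)" if "i < d" "j < d" for i j
    using that A by (metis carrier_matD index_adj)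
  thus ?thesis using A by (intro eq_matI) auto
qed

text \<open>Taking adjoints gives \<open>adj B * Z = 1\<close>, hence
  \<open>B = adj B * Z * B\<close> is a congruence of \<open>Z\<close>. Inverses are always carried
  as such one-sided equations.\<close>

lemma psd_inverse:
  assumes Z: "psd d Z" and B: "B \<in> carrier_mat d d" and ZB: "Z * B = 1\<^sub>m d"
  shows "psd d B"
proof -
  have Z': "Z \<in> carrier_mat d d" using Z by (rule psd_carrier)
  have "adj B * Z = 1\<^sub>m d"
    using arg_cong[OF ZB, of adj] adj_mult[OF Z' B] psd_hermitian[OF Z] by simp
  hence "adj B * Z * B = B" using B by simp
  thus ?thesis using psd_congruence[OF Z B] by simp
qed

section \<open>Traces and the Frobenius norm\<close>

lemma psd_tr:
  assumes "psd d A"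
  shows "Im (tr A) = 0" "Re (tr A) \<ge> 0"
  using assms psd_carrier[OF assms] psd_diag[OF assms] by (auto simp: tr_def intro!: sum_nonneg)

lemma tr_add: "A \<in> carrier_mat d d \<Longrightarrow> B \<in> carrier_mat d d \<Longrightarrow> tr (A + B) = tr A + tr B"
  by (simp add: tr_def sum.distrib)

lemma tr_smult: "A \<in> carrier_mat d d \<Longrightarrow> tr (c \<cdot>\<^sub>m A) = c * tr A"
  by (simp add: tr_def sum_distrib_left)

lemma tr_mult_comm:
  assumes "A \<in> carrier_mat m n" "B \<in> carrier_mat n m"
  shows "tr (A * B) = tr (B * A)"
proof -
  have "tr (A * B) = (\<Sum>i<m. \<Sum>j<n. A $$ (i,j) * B $$ (j,i))"
    using assms by (simp add: tr_def scalar_prod_def atLeast0LessThan)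
  also have "\<dots> = (\<Sum>j<n. \<Sum>i<m. A $$ (i,j) * B $$ (j,i))" by (rule sum.swap)
  also have "\<dots> = tr (B * A)"
    using assms by (simp add: tr_def scalar_prod_def atLeast0LessThan mult_ac)
  finally show ?thesis .
qed

text \<open>The squared Frobenius norm of \<open>A\<close>.\<close>

lemma tr_gram:
  assumes "A \<in> carrier_mat m n"
  shows "tr (adj A * A) = complex_of_real (\<Sum>j<n. \<Sum>i<m. (cmod (A $$ (i,j)))\<^sup>2)"
  using assms unfolding of_real_sum complex_norm_square
  by (simp add: tr_def scalar_prod_def atLeast0LessThan mult_ac)

lemma tr_gram_pos:
  assumes A: "A \<in> carrier_mat m n" and "A \<noteq> 0\<^sub>m m n"
  shows "Re (tr (adj A * A)) > 0"
proof -
  obtain i j where ij: "i < m" "j < n" "A $$ (i,j) \<noteq> 0"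
  proof (rule ccontr)
    assume "\<not> thesis"
    hence "\<And>i j. i < m \<Longrightarrow> j < n \<Longrightarrow> A $$ (i,j) = 0" using that by blast
    hence "A = 0\<^sub>m m n" using A by (intro eq_matI) auto
    thus False using assms(2) by simp
  qed
  have "0 < (\<Sum>j<n. \<Sum>i<m. (cmod (A $$ (i,j)))\<^sup>2)"
    by (rule sum_pos2[of _ j], simp, use ij in simp, rule sum_pos2[of _ i])
       (use ij in \<open>auto intro!: sum_nonneg\<close>)
  thus ?thesis by (simp only: tr_gram[OF A] Re_complex_of_real)
qed

section \<open>Rank-one decompositions and updates\<close>

lemma mat_1_1_eq_tr: "X \<in> carrier_mat 1 1 \<Longrightarrow> X = tr X \<cdot>\<^sub>m 1\<^sub>m 1"
  by (rule eq_matI) (auto simp: tr_def)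

text \<open>Vectors are represented as matrices with one column, so numbers such as the form of
  \<open>Y\<close> at \<open>V\<close> appear as 1 by 1 matrices. This extracts the real
  scalar.\<close>

lemma psd_1_1: "psd 1 X \<Longrightarrow> X = complex_of_real (Re (tr X)) \<cdot>\<^sub>m 1\<^sub>m 1"
  using psd_tr(1)[of 1 X] mat_1_1_eq_tr[OF psd_carrier, of X]
  by (metis complex_is_Real_iff of_real_Re)

text \<open>Congruence by \<open>1 - t E W\<^sup>*\<close>, where \<open>W = A E\<close>; at \<open>t = 1 / a\<close> this removes
  the row and the column of \<open>A\<close> in direction \<open>E\<close>.\<close>

lemma psd_deflate:
  assumes A: "psd d A" and E: "E \<in> carrier_mat d 1"
    and a: "adj E * A * E = complex_of_real a \<cdot>\<^sub>m 1\<^sub>m 1"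
  shows "psd d (A - complex_of_real (2 * t - t\<^sup>2 * a) \<cdot>\<^sub>m (A * E * adj (A * E)))"
proof -
  define W where "W = A * E"
  define X where "X = W * adj W"
  define C where "C = 1\<^sub>m d - complex_of_real t \<cdot>\<^sub>m (E * adj W)"
  have A': "A \<in> carrier_mat d d" using A by (rule psd_carrier)
  have W: "W \<in> carrier_mat d 1" and X: "X \<in> carrier_mat d d" and C: "C \<in> carrier_mat d d"
    and E': "adj E \<in> carrier_mat 1 d" and W': "adj W \<in> carrier_mat 1 d"
    using A' E by (auto simp: W_def X_def C_def)
  have EA: "adj E * A = adj W"
    using adj_mult[OF A' E] psd_hermitian[OF A] by (simp add: W_def)
  have EW: "adj E * W = complex_of_real a \<cdot>\<^sub>m 1\<^sub>m 1"
    using a A' E by (simp add: W_def assoc_mult_mat[OF E' A' E])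
  have AC: "A * C = A - complex_of_real t \<cdot>\<^sub>m X"
  proof -
    have "A * C = A * 1\<^sub>m d - A * (complex_of_real t \<cdot>\<^sub>m (E * adj W))"
      unfolding C_def using A' E W by (intro mult_minus_distrib_mat) auto
    also have "A * (complex_of_real t \<cdot>\<^sub>m (E * adj W)) = complex_of_real t \<cdot>\<^sub>m (A * (E * adj W))"
      using A' E W by (intro mult_smult_distrib) auto
    also have "A * (E * adj W) = X"
      using A' E W' by (simp add: X_def W_def assoc_mult_mat[of _ d d _ 1 _ d])
    finally show ?thesis using A' by simp
  qed
  have adjC: "adj C = 1\<^sub>m d - complex_of_real t \<cdot>\<^sub>m (W * adj E)"
    unfolding C_def using E W adj_mult[OF E W'] by (subst adj_minus[of _ d d]) auto
  have WEA: "W * adj E * A = X"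
    using W E' A' EA by (simp add: X_def assoc_mult_mat[of _ d 1 _ d _ d])
  \<comment> \<open>This yields the term quadratic in \<open>t\<close>: the two cross terms
    contribute \<open>- 2 t X\<close>, this one \<open>t\<^sup>2 a X\<close>.\<close>
  have WEX: "W * adj E * X = complex_of_real a \<cdot>\<^sub>m X"
  proof -
    have "W * adj E * X = W * (adj E * (W * adj W))"
      unfolding X_def using W E' W' by (intro assoc_mult_mat) auto
    also have "adj E * (W * adj W) = (adj E * W) * adj W"
      using W E' W' by (intro assoc_mult_mat[symmetric]) auto
    also have "\<dots> = complex_of_real a \<cdot>\<^sub>m adj W"
      unfolding EW mult_smult_assoc_mat[OF one_carrier_mat W'] left_mult_one_mat[OF W'] ..
    also have "W * (complex_of_real a \<cdot>\<^sub>m adj W) = complex_of_real a \<cdot>\<^sub>m X"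
      unfolding X_def using W W' by (intro mult_smult_distrib) auto
    finally show ?thesis .
  qed
  have WE: "W * adj E \<in> carrier_mat d d" and ACc: "A * C \<in> carrier_mat d d"
    using W E' A' C by auto
  have "adj C * (A * C) = A * C - complex_of_real t \<cdot>\<^sub>m (W * adj E) * (A * C)"
  proof -
    have "complex_of_real t \<cdot>\<^sub>m (W * adj E) \<in> carrier_mat d d" "A * C \<in> carrier_mat d d"
      using W E' A' C by auto
    thus ?thesis
      unfolding adjC
      using minus_mult_distrib_mat[OF one_carrier_mat, of _ d "A * C" d] left_mult_one_mat[of "A * C" d d]
      by simp
  qed
  also have "complex_of_real t \<cdot>\<^sub>m (W * adj E) * (A * C) = complex_of_real t \<cdot>\<^sub>m (W * adj E * (A * C))"
    by (rule mult_smult_assoc_mat[OF WE ACc])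
  also have "W * adj E * (A * C) = W * adj E * A - W * adj E * (complex_of_real t \<cdot>\<^sub>m X)"
    unfolding AC using X by (intro mult_minus_distrib_mat[OF WE A']) auto
  also have "W * adj E * (complex_of_real t \<cdot>\<^sub>m X) = complex_of_real t \<cdot>\<^sub>m (W * adj E * X)"
    by (rule mult_smult_distrib[OF WE X])
  finally have "adj C * (A * C) = A - complex_of_real t \<cdot>\<^sub>m X
      - complex_of_real t \<cdot>\<^sub>m (X - complex_of_real t \<cdot>\<^sub>m (complex_of_real a \<cdot>\<^sub>m X))"
    by (simp only: AC WEA WEX)
  also have "\<dots> = A - complex_of_real (2 * t - t\<^sup>2 * a) \<cdot>\<^sub>m X"
    using A' X by (intro eq_matI) (auto simp: algebra_simps power2_eq_square)
  finally have "adj C * A * C = A - complex_of_real (2 * t - t\<^sup>2 * a) \<cdot>\<^sub>m X"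
    using C A' by (simp add: assoc_mult_mat[of _ d d _ d _ d])
  thus ?thesis using psd_congruence[OF A C] by (simp add: X_def W_def)
qed

text \<open>Cholesky elimination with \<open>s\<close> rows and columns already cleared. The
  induction runs downwards from \<open>s = d\<close>, where the matrix is zero, and each step peels
  off column \<open>s\<close> as one rank-one term.\<close>

lemma psd_cholesky_aux:
  assumes "s \<le> d" "psd d A" "\<And>i j. i < d \<Longrightarrow> j < d \<Longrightarrow> i < s \<or> j < s \<Longrightarrow> A $$ (i,j) = 0"
  shows "\<exists>V. (\<forall>j. V j \<in> carrier_mat d 1) \<and> A = msum d (\<lambda>j. V j * adj (V j)) {s..<d}"
  using assms
proof (induction s arbitrary: A rule: inc_induct)
  case base
  have "A = 0\<^sub>m d d" using base.prems psd_carrier[OF base.prems(1)] by (intro eq_matI) auto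
  thus ?case by (auto intro!: exI[of _ "\<lambda>_. 0\<^sub>m d 1"])
next
  case (step s)
  have A: "A \<in> carrier_mat d d" using step.prems by (simp add: psd_carrier)
  have s: "s < d" using step.hyps by simp
  define E :: "complex mat" where "E = mat d 1 (\<lambda>(i,_). if i = s then 1 else 0)"
  define W where "W = A * E"
  have E: "E \<in> carrier_mat d 1" and W: "W \<in> carrier_mat d 1" using A by (auto simp: E_def W_def)
  have W_nth: "W $$ (i,0) = A $$ (i,s)" if "i < d" for i
    using s index_mult_sum[OF A E that, of 0] unfolding W_def
    by (simp add: E_def if_distrib[of "\<lambda>x. _ * x"] cong: if_cong)
  have WW: "(W * adj W) $$ (i,j) = A $$ (i,s) * cnj (A $$ (j,s))" if "i < d" "j < d" for i j
    using that W by (subst index_mult_sum[of _ d 1]) (auto simp: W_nth)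
  have herm: "cnj (A $$ (j,i)) = A $$ (i,j)" if "i < d" "j < d" for i j
    using psd_hermitian[OF step.prems(1)] that A by (metis carrier_matD index_adj)
  define a where "a = Re (A $$ (s,s))"
  have a: "A $$ (s,s) = complex_of_real a" "a \<ge> 0"
    using psd_diag[OF step.prems(1) s] by (auto simp: a_def complex_eq_iff)
  have EAE: "adj E * A * E = complex_of_real a \<cdot>\<^sub>m 1\<^sub>m 1"
  proof -
    have "(adj E * W) $$ (0,0) = complex_of_real a"
      using s a E W
      by (subst index_mult_sum[of _ 1 d]) (auto simp: W_nth E_def if_distrib[of cnj] if_distribR
           if_distrib[of "\<lambda>x. x * _"] cong: if_cong)
    hence "adj E * W = complex_of_real a \<cdot>\<^sub>m 1\<^sub>m 1"
      using E W by (intro eq_matI) auto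
    thus ?thesis using assoc_mult_mat[of "adj E" 1 d A d E 1] A E by (simp add: W_def)
  qed
  \<comment> \<open>The inverse pivot. For a zero pivot nothing is subtracted, which is correct
    because the whole column then vanishes by \<open>col0\<close>.\<close>
  define c where "c = (if a = 0 then 0 else 1 / a)"
  have c: "c \<ge> 0" using a by (simp add: c_def)
  have col0: "A $$ (i,s) = 0" if a0: "a = 0" and i: "i < d" for i
  proof (rule ccontr)
    assume nz: "A $$ (i,s) \<noteq> 0"
    \<comment> \<open>With \<open>a = 0\<close> the deflated matrix is positive semidefinite for
      every parameter, and its diagonal entry \<open>i\<close> decreases linearly in it. This value
      subtracts the entry plus 1, leaving -1.\<close>
    let ?t = "(Re (A $$ (i,i)) + 1) / (2 * (cmod (A $$ (i,s)))\<^sup>2)"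
    have "psd d (A - complex_of_real (2 * ?t) \<cdot>\<^sub>m (W * adj W))"
      using psd_deflate[OF step.prems(1) E EAE, of ?t] a0 by (simp add: W_def)
    hence "0 \<le> Re (A $$ (i,i)) - 2 * ?t * (cmod (A $$ (i,s)))\<^sup>2"
    proof -
      have "(A - complex_of_real r \<cdot>\<^sub>m (W * adj W)) $$ (i,i)
          = A $$ (i,i) - complex_of_real (r * (cmod (A $$ (i,s)))\<^sup>2)" for r
        using i A W WW[OF i i] complex_norm_square[of "A $$ (i,s)"] by (simp del: index_mult_mat(1))
      thus ?thesis
        using psd_diag(2)[OF \<open>psd d (A - complex_of_real (2 * ?t) \<cdot>\<^sub>m (W * adj W))\<close> i]
        by (simp only: minus_complex.sel Re_complex_of_real)
    qed
    thus False using nz by simp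
  qed
  let ?A = "A - complex_of_real c \<cdot>\<^sub>m (W * adj W)"
  have psd: "psd d ?A"
  proof (cases "a = 0")
    case True
    hence "?A = A" using A W by (intro eq_matI) (auto simp: c_def)
    thus ?thesis using step.prems by simp
  next
    case False
    hence "2 * (1/a) - (1/a)\<^sup>2 * a = c" by (simp add: c_def power2_eq_square)
    thus ?thesis using psd_deflate[OF step.prems(1) E EAE, of "1/a"] by (simp add: W_def)
  qed
  have zero: "?A $$ (i,j) = 0" if ij: "i < d" "j < d" "i < Suc s \<or> j < Suc s" for i j
  proof -
    have eq: "?A $$ (i,j) = A $$ (i,j) - complex_of_real c * A $$ (i,s) * A $$ (s,j)"
      using ij s A W WW[OF ij(1,2)] herm[OF s ij(2)] by (simp del: index_mult_mat(1))
    show ?thesis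
    proof (cases "i < s \<or> j < s")
      case True
      thus ?thesis using step.prems(2) ij s eq by auto
    next
      case False
      hence "i = s \<or> j = s" using ij by auto
      moreover have "A $$ (i,s) = 0 \<and> A $$ (s,j) = 0" if "a = 0"
        using col0[OF that] ij herm[of s j] s by auto
      ultimately show ?thesis using eq a by (cases "a = 0") (auto simp: c_def)
    qed
  qed
  obtain V where V: "\<And>j. V j \<in> carrier_mat d 1" "?A = msum d (\<lambda>j. V j * adj (V j)) {Suc s..<d}"
    using step.IH[OF psd zero] by blast
  define V' where "V' = V(s := complex_of_real (sqrt c) \<cdot>\<^sub>m W)"
  have V's: "V' s * adj (V' s) = complex_of_real c \<cdot>\<^sub>m (W * adj W)"
  proof -
    have "V' s * adj (V' s) = complex_of_real (sqrt c) \<cdot>\<^sub>m (complex_of_real (sqrt c) \<cdot>\<^sub>m (W * adj W))"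
      using W mult_smult_distrib[of "complex_of_real (sqrt c) \<cdot>\<^sub>m W" d 1 "adj W" d]
        mult_smult_assoc_mat[of W d 1 "adj W" d] by (simp add: V'_def)
    also have "\<dots> = complex_of_real c \<cdot>\<^sub>m (W * adj W)"
      using c W by (intro eq_matI) (auto simp flip: of_real_mult mult.assoc)
    finally show ?thesis .
  qed
  have "msum d (\<lambda>j. V' j * adj (V' j)) {s..<d} = V' s * adj (V' s) + msum d (\<lambda>j. V' j * adj (V' j)) {Suc s..<d}"
  proof -
    have "{s..<d} = insert s {Suc s..<d}" using s by auto
    moreover have "V' s * adj (V' s) \<in> carrier_mat d d" using V's W by simp
    ultimately show ?thesis by (simp add: msum_insert)
  qed
  also have "msum d (\<lambda>j. V' j * adj (V' j)) {Suc s..<d} = ?A"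
    unfolding V(2) by (rule eq_matI) (auto simp: V'_def intro!: sum.cong)
  also have "V' s * adj (V' s) + ?A = A"
    unfolding V's using A W by (intro eq_matI) auto
  finally show ?case using V(1) W by (intro exI[of _ V']) (auto simp: V'_def)
qed

lemma psd_rank_one_decomposition:
  assumes "psd d A"
  obtains V where "\<And>j. V j \<in> carrier_mat d 1" "A = msum d (\<lambda>j. V j * adj (V j)) {..<d}"
  using psd_cholesky_aux[of 0 d A] assms by (auto simp: atLeast0LessThan)

section \<open>Shifting the barrier and rank-one updates of the inverse\<close>

text \<open>Raising the barrier by \<open>\<delta>\<close> lowers the potential. The resolvent
  identity \<open>Z = Y + \<delta> Z Y\<close>, with its mirror image inserted for \<open>Z\<close>
  in the product \<open>Z Y\<close>, gives \<open>tr Z = tr Y + \<delta> tr (Y Y) + \<delta>\<^sup>2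
  tr (Y Z Y)\<close>, and the last term is nonnegative.\<close>

lemma psd_add_scalar_inverse:
  assumes Z: "psd d Z" and B: "B \<in> carrier_mat d d" and ZB: "Z * B = 1\<^sub>m d" and \<delta>: "\<delta> > 0"
  obtains Y where "psd d Y" "Y * (B + complex_of_real \<delta> \<cdot>\<^sub>m 1\<^sub>m d) = 1\<^sub>m d"
    "Re (tr Y) + \<delta> * Re (tr (Y * Y)) \<le> Re (tr Z)"
proof -
  define B' where "B' = B + complex_of_real \<delta> \<cdot>\<^sub>m 1\<^sub>m d"
  have B': "B' \<in> carrier_mat d d" using B by (simp add: B'_def)
  have Zc: "Z \<in> carrier_mat d d" using Z by (rule psd_carrier)
  have psdB: "psd d B" by (rule psd_inverse[OF Z B ZB])
  have psdB': "psd d B'" unfolding B'_def using psdB \<delta> by (intro psd_add psd_smult psd_one) auto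
  \<comment> \<open>A null vector \<open>v\<close> of \<open>B'\<close> would make the form of
    \<open>B\<close> plus \<open>\<delta>\<close> times the squared norm of \<open>v\<close> vanish,
    although the former is nonnegative and the latter positive.\<close>
  have "det B' \<noteq> 0"
  proof
    assume "det B' = 0"
    then obtain v where v: "v \<in> carrier_vec d" "v \<noteq> 0\<^sub>v d" "B' *\<^sub>v v = 0\<^sub>v d"
      using det_0_iff_vec_prod_zero[OF B'] by auto
    have "(B' *\<^sub>v v) \<bullet>c v = (B *\<^sub>v v) \<bullet>c v + complex_of_real \<delta> * (v \<bullet>c v)"
    proof -
      have "B' *\<^sub>v v = B *\<^sub>v v + complex_of_real \<delta> \<cdot>\<^sub>v v"
        unfolding B'_def using B v by (intro eq_vecI) (auto simp: add_scalar_prod_distrib[of _ d])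
      thus ?thesis using B v by (simp add: add_scalar_prod_distrib[of _ d])
    qed
    moreover have "Re ((B *\<^sub>v v) \<bullet>c v) \<ge> 0" using psdB v by (simp add: psd_def)
    moreover have "v \<bullet>c v = complex_of_real (\<Sum>i<d. (cmod (v $ i))\<^sup>2)"
      using v by (intro cscalar_prod_self)
    moreover have "0 < (\<Sum>i<d. (cmod (v $ i))\<^sup>2)"
    proof -
      obtain i where "i < d" "v $ i \<noteq> 0" using v by (metis carrier_vecD eq_vecI index_zero_vec)
      thus ?thesis by (intro sum_pos2[of _ i]) auto
    qed
    moreover have "(B' *\<^sub>v v) \<bullet>c v = 0" using v by simp
    ultimately have "Re ((B *\<^sub>v v) \<bullet>c v) + \<delta> * (\<Sum>i<d. (cmod (v $ i))\<^sup>2) = 0"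
      by (metis Re_complex_of_real of_real_mult plus_complex.sel(1) zero_complex.sel(1))
    with \<open>Re ((B *\<^sub>v v) \<bullet>c v) \<ge> 0\<close> \<open>0 < (\<Sum>i<d. (cmod (v $ i))\<^sup>2)\<close> \<delta> show False
      by (smt (verit) mult_pos_pos)
  qed
  then obtain Y where Y: "Y \<in> carrier_mat d d" "Y * B' = 1\<^sub>m d" "B' * Y = 1\<^sub>m d"
    using det_non_zero_imp_unit[OF B'] by (auto simp: Units_def ring_mat_def)
  have psdY: "psd d Y" by (rule psd_inverse[OF psdB' Y(1,3)])
  have ZB': "Z * B' = 1\<^sub>m d + complex_of_real \<delta> \<cdot>\<^sub>m Z"
    unfolding B'_def using Zc B ZB by (simp add: mult_add_distrib_mat[of _ d d] mult_smult_distrib[OF Zc one_carrier_mat])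
  have B'Z: "B' * Z = 1\<^sub>m d + complex_of_real \<delta> \<cdot>\<^sub>m Z"
    unfolding B'_def using Zc B mat_mult_left_right_inverse[OF Zc B ZB]
    by (simp add: add_mult_distrib_mat[of _ d d] mult_smult_assoc_mat[of _ d d])
  have Z1: "Z = Y + complex_of_real \<delta> \<cdot>\<^sub>m (Z * Y)"
  proof -
    have "Z = Z * B' * Y" using Zc B' Y by (simp add: assoc_mult_mat[of _ d d _ d _ d])
    thus ?thesis unfolding ZB' using Zc Y
      by (simp add: add_mult_distrib_mat[of _ d d] mult_smult_assoc_mat[of _ d d])
  qed
  have Z2: "Z = Y + complex_of_real \<delta> \<cdot>\<^sub>m (Y * Z)"
  proof -
    have "Z = Y * (B' * Z)" using Zc B' Y by (simp flip: assoc_mult_mat[of _ d d _ d _ d])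
    also have "\<dots> = Y * 1\<^sub>m d + Y * (complex_of_real \<delta> \<cdot>\<^sub>m Z)"
      unfolding B'Z using Zc Y by (intro mult_add_distrib_mat) auto
    also have "\<dots> = Y + complex_of_real \<delta> \<cdot>\<^sub>m (Y * Z)"
      using Zc Y by (simp add: mult_smult_distrib[OF Y(1) Zc])
    finally show ?thesis .
  qed
  have "Z * Y = Y * Y + complex_of_real \<delta> \<cdot>\<^sub>m (Y * Z * Y)"
    using arg_cong[OF Z2, of "\<lambda>X. X * Y"] Zc Y
    by (simp add: add_mult_distrib_mat[of _ d d] mult_smult_assoc_mat[of _ d d])
  hence "tr (Z * Y) = tr (Y * Y) + complex_of_real \<delta> * tr (Y * Z * Y)"
  proof -
    have "Y * Y \<in> carrier_mat d d" "Y * Z * Y \<in> carrier_mat d d" using Zc Y by auto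
    hence "tr (Y * Y + complex_of_real \<delta> \<cdot>\<^sub>m (Y * Z * Y)) = tr (Y * Y) + complex_of_real \<delta> * tr (Y * Z * Y)"
      by (simp only: tr_add[of _ d] tr_smult[of _ d] smult_carrier_mat)
    thus ?thesis using \<open>Z * Y = _\<close> by argo
  qed
  moreover have "tr Z = tr Y + complex_of_real \<delta> * tr (Z * Y)"
    using arg_cong[OF Z1, of tr] Zc Y by (simp add: tr_add[of _ d] tr_smult[of _ d])
  moreover have "Re (tr (Y * Z * Y)) \<ge> 0"
    using psd_tr(2)[OF psd_congruence[OF Z Y(1)]] psd_hermitian[OF psdY] by simp
  ultimately have "Re (tr Y) + \<delta> * Re (tr (Y * Y)) \<le> Re (tr Z)"
    using \<delta> by (simp add: algebra_simps)
  thus ?thesis using that psdY Y(2) unfolding B'_def by blast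
qed

text \<open>Sherman-Morrison with the weight tuned to a prescribed potential increase
  \<open>g\<close>. Let \<open>W = Y V\<close>, \<open>n\<close> its squared norm and
  \<open>y\<close> the form of \<open>Y\<close> at \<open>V\<close>. Subtracting weight
  \<open>t\<close> adds \<open>c W adj W\<close> to the inverse, where
  \<open>c = t / (1 - t y)\<close>. At \<open>t = 1 / U\<close> this is
  \<open>1 / (U - y) = g / n\<close>, so the trace rises by exactly \<open>c n = g\<close>. Since
  \<open>c\<close> is nonnegative, positivity of the new inverse is immediate.\<close>

lemma rank_one_update:
  assumes Y: "psd d Y" and B: "B \<in> carrier_mat d d" and YB: "Y * B = 1\<^sub>m d"
    and V: "V \<in> carrier_mat d 1" "V \<noteq> 0\<^sub>m d 1" and g: "g > 0"
    and U: "U = Re (tr (adj V * (Y * Y) * V)) / g + Re (tr (adj V * Y * V))"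
  shows "U > 0" "\<exists>Z. psd d Z \<and> Z * (B - complex_of_real (1 / U) \<cdot>\<^sub>m (V * adj V)) = 1\<^sub>m d
      \<and> Re (tr Z) = Re (tr Y) + g"
proof -
  define W where "W = Y * V"
  have Yc: "Y \<in> carrier_mat d d" using Y by (rule psd_carrier)
  have W: "W \<in> carrier_mat d 1" using Yc V by (simp add: W_def)
  have V': "adj V \<in> carrier_mat 1 d" and W': "adj W \<in> carrier_mat 1 d" using V W by auto
  have adjW: "adj W = adj V * Y"
    using adj_mult[OF Yc V(1)] psd_hermitian[OF Y] by (simp add: W_def)
  have BY: "B * Y = 1\<^sub>m d" by (rule mat_mult_left_right_inverse[OF Yc B YB])
  define n where "n = Re (tr (adj W * W))"
  define y where "y = Re (tr (adj V * Y * V))"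
  have n_eq: "n = Re (tr (adj V * (Y * Y) * V))"
  proof -
    have "adj W * W = adj V * Y * (Y * V)" by (simp only: adjW) (simp add: W_def)
    also have "\<dots> = adj V * Y * Y * V"
      using V V' Yc by (intro assoc_mult_mat[symmetric]) auto
    also have "adj V * Y * Y = adj V * (Y * Y)"
      using V' Yc by (intro assoc_mult_mat) auto
    finally show ?thesis by (simp add: n_def)
  qed
  have "W \<noteq> 0\<^sub>m d 1"
  proof
    assume "W = 0\<^sub>m d 1"
    moreover have "B * W = V"
      unfolding W_def using B Yc V BY by (simp flip: assoc_mult_mat[of _ d d _ d _ 1])
    ultimately show False using V B by simp
  qed
  hence n: "n > 0" unfolding n_def by (rule tr_gram_pos[OF W])
  have psdy: "psd 1 (adj V * Y * V)" by (rule psd_congruence[OF Y V(1)])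
  have y: "y \<ge> 0" using psd_tr(2)[OF psdy] by (simp add: y_def)
  have U_eq: "U = n / g + y" using U n_eq y_def by simp
  show U_pos: "U > 0" using n g y unfolding U_eq by (simp add: add_pos_nonneg)
  have WV: "adj W * V = complex_of_real y \<cdot>\<^sub>m 1\<^sub>m 1"
    using psd_1_1[OF psdy] by (simp add: adjW y_def)
  define t where "t = 1 / U"
  define c where "c = g / n"
  \<comment> \<open>The Sherman-Morrison condition: this is the coefficient of
    \<open>W * adj V\<close> in the product that has to be the identity.\<close>
  have tc: "c - t - c * t * y = 0"
    using n g y U_pos by (simp add: t_def c_def U_eq field_simps)
  define Z where "Z = Y + complex_of_real c \<cdot>\<^sub>m (W * adj W)"
  have c: "c \<ge> 0" using n g by (simp add: c_def)
  have "psd d Z" unfolding Z_def using Y c W by (intro psd_add psd_smult psd_gram') auto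
  moreover have "Re (tr Z) = Re (tr Y) + g"
  proof -
    have "tr (W * adj W) = tr (adj W * W)" by (rule tr_mult_comm[OF W W'])
    thus ?thesis using Yc W W' n by (simp add: Z_def tr_add[of _ d] tr_smult[of _ d] n_def[symmetric] c_def)
  qed
  moreover have "Z * (B - complex_of_real t \<cdot>\<^sub>m (V * adj V)) = 1\<^sub>m d"
  proof -
    let ?P = "V * adj V" and ?Q = "W * adj V"
    have P: "?P \<in> carrier_mat d d" and Q: "?Q \<in> carrier_mat d d"
      and WW: "W * adj W \<in> carrier_mat d d" using V W by auto
    have YP: "Y * ?P = ?Q"
      using Yc V V' by (simp add: W_def assoc_mult_mat[of _ d d _ 1 _ d])
    have "adj W * B = adj V"
      unfolding adjW assoc_mult_mat[OF V' Yc B] YB by (rule right_mult_one_mat[OF V'])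
    hence WB: "(W * adj W) * B = ?Q"
      using W W' B by (simp add: assoc_mult_mat[of _ d 1 _ d _ d])
    have WP: "(W * adj W) * ?P = complex_of_real y \<cdot>\<^sub>m ?Q"
    proof -
      have "(W * adj W) * ?P = W * (adj W * ?P)" using W W' P by (intro assoc_mult_mat) auto
      also have "adj W * ?P = adj W * V * adj V" using W' V V' by (intro assoc_mult_mat[symmetric]) auto
      also have "\<dots> = complex_of_real y \<cdot>\<^sub>m adj V"
        unfolding WV mult_smult_assoc_mat[OF one_carrier_mat V'] left_mult_one_mat[OF V'] ..
      also have "W * \<dots> = complex_of_real y \<cdot>\<^sub>m ?Q" using W V' by (intro mult_smult_distrib) auto
      finally show ?thesis .
    qed
    have ZB: "Z * B = 1\<^sub>m d + complex_of_real c \<cdot>\<^sub>m ?Q"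
      unfolding Z_def using Yc WW B YB WB
      by (simp add: add_mult_distrib_mat[of _ d d] mult_smult_assoc_mat[of _ d d])
    have ZP: "Z * ?P = ?Q + complex_of_real c \<cdot>\<^sub>m (complex_of_real y \<cdot>\<^sub>m ?Q)"
      unfolding Z_def using Yc WW P YP WP
      by (simp add: add_mult_distrib_mat[of _ d d] mult_smult_assoc_mat[of _ d d])
    have Zc: "Z \<in> carrier_mat d d" using Yc WW by (simp add: Z_def)
    have "Z * (B - complex_of_real t \<cdot>\<^sub>m ?P) = Z * B - complex_of_real t \<cdot>\<^sub>m (Z * ?P)"
      using Zc B P by (simp add: mult_minus_distrib_mat[of _ d d] mult_smult_distrib[of _ d d])
    also have "\<dots> = 1\<^sub>m d + complex_of_real (c - t - c * t * y) \<cdot>\<^sub>m ?Q"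
      unfolding ZB ZP using Q by (intro eq_matI) (auto simp: algebra_simps)
    also have "\<dots> = 1\<^sub>m d" unfolding tc of_real_0
      using Q V(1) W by (intro eq_matI) (auto simp del: index_mult_mat(1))
    finally show ?thesis .
  qed
  ultimately show "\<exists>Z. psd d Z \<and> Z * (B - complex_of_real (1 / U) \<cdot>\<^sub>m (V * adj V)) = 1\<^sub>m d
      \<and> Re (tr Z) = Re (tr Y) + g"
    unfolding t_def by blast
qed

text \<open>By cyclicity each summand is the trace of \<open>A\<close> times
  \<open>V j * adj (V j)\<close>, which is linear in the latter, so the resolution of the identity
  collapses the sum. It evaluates the total of the scores \<open>U j\<close> in the walk.\<close>

lemma sum_tr_resolution:
  assumes V: "\<And>j. j \<in> J \<Longrightarrow> V j \<in> carrier_mat d 1" and A: "A \<in> carrier_mat d d"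
    and one: "msum d (\<lambda>j. V j * adj (V j)) J = 1\<^sub>m d"
  shows "(\<Sum>j\<in>J. tr (adj (V j) * A * V j)) = tr A"
proof -
  have "(\<Sum>j\<in>J. tr (adj (V j) * A * V j)) = (\<Sum>j\<in>J. tr (A * (V j * adj (V j))))"
  proof (rule sum.cong[OF refl])
    fix j assume "j \<in> J"
    hence Vj: "V j \<in> carrier_mat d 1" "adj (V j) \<in> carrier_mat 1 d" using V by auto
    have "tr (adj (V j) * A * V j) = tr (adj (V j) * (A * V j))"
      using assoc_mult_mat[OF Vj(2) A Vj(1)] by simp
    also have "\<dots> = tr (A * V j * adj (V j))" using Vj A by (intro tr_mult_comm) auto
    also have "A * V j * adj (V j) = A * (V j * adj (V j))"
      by (rule assoc_mult_mat[OF A Vj])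
    finally show "tr (adj (V j) * A * V j) = tr (A * (V j * adj (V j)))" .
  qed
  also have "\<dots> = (\<Sum>j\<in>J. \<Sum>i<d. \<Sum>k<d. A $$ (i,k) * (V j * adj (V j)) $$ (k,i))"
  proof (rule sum.cong[OF refl])
    fix j assume "j \<in> J"
    hence X: "V j * adj (V j) \<in> carrier_mat d d"
      using V by (intro mult_carrier_mat[of _ _ 1]) auto
    show "tr (A * (V j * adj (V j))) = (\<Sum>i<d. \<Sum>k<d. A $$ (i,k) * (V j * adj (V j)) $$ (k,i))"
      unfolding tr_def using A X by (auto simp: index_mult_sum[OF A X] simp del: index_mult_mat(1) intro!: sum.cong)
  qed
  also have "\<dots> = (\<Sum>i<d. \<Sum>k<d. A $$ (i,k) * (\<Sum>j\<in>J. (V j * adj (V j)) $$ (k,i)))"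
    unfolding sum_distrib_left by (subst sum.swap, intro sum.cong refl, rule sum.swap)
  also have "\<dots> = (\<Sum>i<d. \<Sum>k<d. A $$ (i,k) * 1\<^sub>m d $$ (k,i))"
  proof (intro sum.cong refl)
    fix i k assume "i \<in> {..<d}" "k \<in> {..<d}"
    thus "A $$ (i,k) * (\<Sum>j\<in>J. (V j * adj (V j)) $$ (k,i)) = A $$ (i,k) * 1\<^sub>m d $$ (k,i)"
      using arg_cong[OF one, of "\<lambda>X. X $$ (k,i)"] by simp
  qed
  also have "\<dots> = (\<Sum>i<d. A $$ (i,i))"
    by (rule sum.cong) (simp_all add: if_distrib[of "\<lambda>x. _ * x"] cong: if_cong)
  finally show ?thesis using A by (simp add: tr_def)
qed

section \<open>The barrier walk\<close>

text \<open>Membership of \<open>c\<close> in the convex hull of \<open>F\<close>, with the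
  distribution indexed by an initial segment of the naturals to fit \<open>prob_dist\<close>. Only
  the expectation of the random walk is recorded in this way, with no probability space.\<close>

definition mixture :: "(nat \<Rightarrow> real) set \<Rightarrow> (nat \<Rightarrow> real) \<Rightarrow> bool" where
  "mixture F c \<longleftrightarrow> (\<exists>r p t. prob_dist r p \<and> (\<forall>b<r. t b \<in> F) \<and> (\<forall>j. c j = (\<Sum>b<r. p b * t b j)))"

lemma mixture_single: "t \<in> F \<Longrightarrow> mixture F t"
  unfolding mixture_def prob_dist_def
  by (intro exI[of _ 1] exI[of _ "\<lambda>_. 1"] exI[of _ "\<lambda>_. t"]) auto

text \<open>Used with \<open>a = 1\<close> to add the weight chosen in the first step to all
  continuations of the walk, and with \<open>s = 0\<close> to rescale the final barrier.\<close>

lemma mixture_affine: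
  assumes "mixture F c" "\<And>t. t \<in> F \<Longrightarrow> (\<lambda>j. a * t j + s j) \<in> G"
  shows "mixture G (\<lambda>j. a * c j + s j)"
proof -
  from assms(1) obtain r p t where *: "prob_dist r p" "\<forall>b<r. t b \<in> F" "\<And>j. c j = (\<Sum>b<r. p b * t b j)"
    unfolding mixture_def by blast
  have "a * c j + s j = (\<Sum>b<r. p b * (a * t b j + s j))" for j
  proof -
    have "(\<Sum>b<r. p b * (a * t b j + s j)) = a * (\<Sum>b<r. p b * t b j) + (\<Sum>b<r. p b) * s j"
      by (simp add: sum_distrib_left sum_distrib_right sum.distrib algebra_simps)
    thus ?thesis using * by (simp add: prob_dist_def)
  qed
  thus ?thesis unfolding mixture_def using * assms(2)
    by (intro exI[of _ r] exI[of _ p] exI[of _ "\<lambda>b j. a * t b j + s j"]) auto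
qed

text \<open>Two-stage sampling: draw \<open>i\<close> with probability \<open>w i\<close>, then draw
  from the mixture for \<open>i\<close>. The dependent pairs are enumerated by a bijection to obtain
  a single distribution.\<close>

lemma mixture_mixture:
  assumes I: "finite I" and w: "\<And>i. i \<in> I \<Longrightarrow> w i \<ge> 0" "sum w I = 1"
    and c: "\<And>i. i \<in> I \<Longrightarrow> mixture F (c i)"
  shows "mixture F (\<lambda>j. \<Sum>i\<in>I. w i * c i j)"
proof -
  have "\<forall>i\<in>I. \<exists>r p t. prob_dist r p \<and> (\<forall>b<r. t b \<in> F) \<and> (\<forall>j. c i j = (\<Sum>b<r. p b * t b j))"
    using c unfolding mixture_def by blast
  then obtain r p t where rpt: "\<And>i. i \<in> I \<Longrightarrow> prob_dist (r i) (p i)"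
      "\<And>i b. i \<in> I \<Longrightarrow> b < r i \<Longrightarrow> t i b \<in> F"
      "\<And>i j. i \<in> I \<Longrightarrow> c i j = (\<Sum>b<r i. p i b * t i b j)"
    by metis
  define S where "S = (SIGMA i:I. {..<r i})"
  have S: "finite S" using I by (simp add: S_def)
  obtain h where h: "bij_betw h {..<card S} S"
    using ex_bij_betw_nat_finite[OF S] by (auto simp: atLeast0LessThan)
  have hS: "h b \<in> S" if "b < card S" for b using bij_betwE[OF h] that by auto
  have sum_h: "(\<Sum>b<card S. f (h b)) = (\<Sum>i\<in>I. \<Sum>b<r i. f (i,b))" for f :: "_ \<Rightarrow> real"
    using sum.reindex_bij_betw[OF h, of f] I by (simp add: S_def sum.Sigma)
  let ?p = "\<lambda>b. w (fst (h b)) * p (fst (h b)) (snd (h b))"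
  let ?t = "\<lambda>b. t (fst (h b)) (snd (h b))"
  have "prob_dist (card S) ?p"
    unfolding prob_dist_def
  proof (intro conjI allI impI)
    fix b assume "b < card S"
    from hS[OF this] show "0 \<le> ?p b"
      using w rpt(1) by (auto simp: S_def prob_dist_def)
  next
    have "(\<Sum>b<card S. ?p b) = (\<Sum>i\<in>I. w i * (\<Sum>b<r i. p i b))"
      using sum_h[of "\<lambda>x. w (fst x) * p (fst x) (snd x)"] by (simp add: sum_distrib_left)
    also have "\<dots> = 1" using rpt(1) w(2) by (simp add: prob_dist_def)
    finally show "(\<Sum>b<card S. ?p b) = 1" .
  qed
  moreover have "\<forall>b<card S. ?t b \<in> F" using hS rpt(2) by (fastforce simp: S_def mem_Sigma_iff)
  moreover have "(\<Sum>i\<in>I. w i * c i j) = (\<Sum>b<card S. ?p b * ?t b j)" for j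
    using sum_h[of "\<lambda>x. w (fst x) * p (fst x) (snd x) * t (fst x) (snd x) j"] rpt(3)
    by (simp add: sum_distrib_left mult.assoc)
  ultimately show ?thesis
    unfolding mixture_def by (intro exI[of _ "card S"] exI[of _ ?p] exI[of _ ?t]) simp
qed

text \<open>What a run of \<open>T\<close> steps leaves behind. The support is bounded rather than
  the number of additions, so a step may add nothing or increase a weight that is already
  positive.\<close>

definition sparse_weights :: "nat \<Rightarrow> nat \<Rightarrow> (nat \<Rightarrow> complex mat) \<Rightarrow> nat \<Rightarrow> complex mat \<Rightarrow> (nat \<Rightarrow> real) set" where
  "sparse_weights d J V T B = {t. (\<forall>j. t j \<ge> 0) \<and> card {j. j < J \<and> t j \<noteq> 0} \<le> T \<and>
     psd d (B - msum d (\<lambda>j. complex_of_real (t j) \<cdot>\<^sub>m (V j * adj (V j))) {..<J})}"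

text \<open>Induction on the number of steps left: the first step is made explicitly and the rest
  starts from the updated \<open>B\<close>. The inverse \<open>Z\<close> certifies that the barrier
  has not been crossed, and \<open>\<epsilon>\<close> bounds the potential all along. Each nonzero
  piece gains \<open>1 / (1 / \<delta> + \<epsilon>)\<close> per step on average; zero pieces are
  never drawn, so nothing is claimed about their weights.\<close>

lemma barrier_walk:
  assumes d: "d \<ge> 1" and V: "\<And>j. j < J \<Longrightarrow> V j \<in> carrier_mat d 1"
    and one: "msum d (\<lambda>j. V j * adj (V j)) {..<J} = 1\<^sub>m d"
    and \<delta>: "\<delta> > 0" and Z: "psd d Z" "Z * B = 1\<^sub>m d" "Re (tr Z) \<le> \<epsilon>" and B: "B \<in> carrier_mat d d"
  shows "\<exists>c. mixture (sparse_weights d J V T (B + complex_of_real (real T * \<delta>) \<cdot>\<^sub>m 1\<^sub>m d)) c \<and>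
     (\<forall>j<J. V j \<noteq> 0\<^sub>m d 1 \<longrightarrow> c j = real T / (1 / \<delta> + \<epsilon>))"
  using Z B
proof (induction T arbitrary: B Z)
  case 0
  have "psd d B" by (rule psd_inverse[OF 0(1) 0(4) 0(2)])
  moreover have "B + complex_of_real (real 0 * \<delta>) \<cdot>\<^sub>m 1\<^sub>m d
      - msum d (\<lambda>j. complex_of_real 0 \<cdot>\<^sub>m (V j * adj (V j))) {..<J} = B"
  proof -
    have "(complex_of_real 0 \<cdot>\<^sub>m (V j * adj (V j))) $$ (a,b) = 0" if "j < J" "a < d" "b < d" for j a b
      using V[OF that(1)] that by auto
    thus ?thesis using 0(4) by (intro eq_matI) (auto intro!: sum.neutral)
  qed
  ultimately have "(\<lambda>_. 0) \<in> sparse_weights d J V 0 (B + complex_of_real (real 0 * \<delta>) \<cdot>\<^sub>m 1\<^sub>m d)"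
    by (simp add: sparse_weights_def)
  thus ?case by (intro exI[of _ "\<lambda>_. 0"] conjI mixture_single) auto
next
  case (Suc T)
  note B = Suc.prems(4)
  define X where "X j = V j * adj (V j)" for j
  have X: "X j \<in> carrier_mat d d" if "j < J" for j
    unfolding X_def using V[OF that] by (intro mult_carrier_mat[of _ _ 1]) auto
  obtain Y where Y: "psd d Y" "Y * (B + complex_of_real \<delta> \<cdot>\<^sub>m 1\<^sub>m d) = 1\<^sub>m d"
    "Re (tr Y) + \<delta> * Re (tr (Y * Y)) \<le> Re (tr Z)"
    using psd_add_scalar_inverse[OF Suc.prems(1) B Suc.prems(2) \<delta>] by blast
  define B' where "B' = B + complex_of_real \<delta> \<cdot>\<^sub>m 1\<^sub>m d"
  have B': "B' \<in> carrier_mat d d" using B by (simp add: B'_def)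
  have YB': "Y * B' = 1\<^sub>m d" using Y by (simp add: B'_def)
  have Yc: "Y \<in> carrier_mat d d" using Y(1) by (rule psd_carrier)
  \<comment> \<open>The amount of potential freed by the shift, to be spent entirely on the rank-one
    update.\<close>
  define g where "g = \<delta> * Re (tr (Y * Y))"
  \<comment> \<open>Here \<open>d \<ge> 1\<close> enters: it makes \<open>g\<close> positive, so
    that dividing by it is legitimate.\<close>
  have "Y \<noteq> 0\<^sub>m d d"
  proof
    assume "Y = 0\<^sub>m d d"
    hence "1\<^sub>m d = (0\<^sub>m d d :: complex mat)" using YB' B' by simp
    from arg_cong[OF this, of "\<lambda>A. A $$ (0,0)"] d show False by simp
  qed
  hence \<tau>: "Re (tr (Y * Y)) > 0"
    using tr_gram_pos[OF Yc] psd_hermitian[OF Y(1)] by simp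
  hence g: "g > 0" using \<delta> by (simp add: g_def)
  define C where "C = 1 / \<delta> + \<epsilon>"
  have trY: "0 \<le> Re (tr Y)" "Re (tr Y) + g \<le> \<epsilon>"
    using psd_tr(2)[OF Y(1)] Y(3) Suc.prems(3) by (auto simp: g_def)
  have C: "C > 0" using \<delta> trY g by (simp add: C_def add_pos_nonneg)
  define U where "U j = Re (tr (adj (V j) * (Y * Y) * V j)) / g + Re (tr (adj (V j) * Y * V j))" for j
  have YY: "psd d (Y * Y)" using psd_gram[OF Yc] psd_hermitian[OF Y(1)] by simp
  have U_nonneg: "U j \<ge> 0" if "j < J" for j
    using psd_tr(2)[OF psd_congruence[OF YY V[OF that]]] psd_tr(2)[OF psd_congruence[OF Y(1) V[OF that]]] g
    by (simp add: U_def)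
  \<comment> \<open>The first parts of the scores add up to
    \<open>tr (Y * Y) / g = 1 / \<delta>\<close>, the second parts to \<open>tr Y\<close>, which is
    at most \<open>\<epsilon>\<close>.\<close>
  have "(\<Sum>j<J. U j) = 1 / \<delta> + Re (tr Y)"
  proof -
    have "(\<Sum>j<J. U j) = Re (\<Sum>j<J. tr (adj (V j) * (Y * Y) * V j)) / g + Re (\<Sum>j<J. tr (adj (V j) * Y * V j))"
      by (simp only: U_def sum.distrib Re_sum sum_divide_distrib)
    also have "(\<Sum>j<J. tr (adj (V j) * (Y * Y) * V j)) = tr (Y * Y)"
      using V Yc by (intro sum_tr_resolution[OF _ _ one]) auto
    also have "(\<Sum>j<J. tr (adj (V j) * Y * V j)) = tr Y"
      using V Yc by (intro sum_tr_resolution[OF _ _ one]) auto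
    finally show ?thesis using \<tau> \<delta> by (simp add: g_def)
  qed
  hence sumU: "(\<Sum>j<J. U j) \<le> C" using trY g by (simp add: C_def)
  define I where "I = {j. j < J \<and> V j \<noteq> 0\<^sub>m d 1}"
  have I: "finite I" "I \<subseteq> {..<J}" by (auto simp: I_def)
  have U_pos: "U j > 0" if "j \<in> I" for j
    using that rank_one_update(1)[OF Y(1) B' YB' V _ g U_def] by (auto simp: I_def)
  define G where "G = sparse_weights d J V (Suc T) (B + complex_of_real (real (Suc T) * \<delta>) \<cdot>\<^sub>m 1\<^sub>m d)"
  \<comment> \<open>One step of the walk: index \<open>j \<in> I\<close> adds the vector \<open>V j\<close> with weight \<open>1 / U j\<close>,
    index \<open>J\<close> adds nothing. Drawing \<open>j\<close> with probability \<open>U j / C\<close>, every coordinate grows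
    by \<open>1 / C\<close> in expectation.\<close>
  have step: "\<exists>c. mixture G c \<and>
      (\<forall>i\<in>I. c i = real T / C + (if i = l then 1 / U l else 0))" if l: "l \<in> insert J I" for l
  proof (cases "l = J")
    case True
    obtain c where c: "mixture (sparse_weights d J V T (B' + complex_of_real (real T * \<delta>) \<cdot>\<^sub>m 1\<^sub>m d)) c"
      "\<forall>j<J. V j \<noteq> 0\<^sub>m d 1 \<longrightarrow> c j = real T / C"
      using Suc.IH[OF Y(1) YB' _ B'] trY g unfolding C_def by fastforce
    have "B' + complex_of_real (real T * \<delta>) \<cdot>\<^sub>m 1\<^sub>m d
        = B + complex_of_real (real (Suc T) * \<delta>) \<cdot>\<^sub>m 1\<^sub>m d"
      unfolding B'_def using B by (intro eq_matI) (auto simp: algebra_simps)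
    hence "mixture G (\<lambda>j. 1 * c j + 0)"
      by (intro mixture_affine[OF c(1)]) (auto simp: G_def sparse_weights_def)
    thus ?thesis using c(2) True by (intro exI[of _ c]) (auto simp: I_def)
  next
    case False
    hence l: "l < J" "V l \<noteq> 0\<^sub>m d 1" "l \<in> I" using l by (auto simp: I_def)
    obtain Z' where Z': "psd d Z'" "Z' * (B' - complex_of_real (1 / U l) \<cdot>\<^sub>m X l) = 1\<^sub>m d"
      "Re (tr Z') = Re (tr Y) + g"
      using rank_one_update(2)[OF Y(1) B' YB' V[OF l(1)] l(2) g U_def] unfolding X_def by blast
    have B'': "B' - complex_of_real (1 / U l) \<cdot>\<^sub>m X l \<in> carrier_mat d d"
      using B' X[OF l(1)] by auto
    obtain c where c: "mixture (sparse_weights d J V T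
        (B' - complex_of_real (1 / U l) \<cdot>\<^sub>m X l + complex_of_real (real T * \<delta>) \<cdot>\<^sub>m 1\<^sub>m d)) c"
      "\<forall>j<J. V j \<noteq> 0\<^sub>m d 1 \<longrightarrow> c j = real T / C"
      using Suc.IH[OF Z'(1,2) _ B''] trY Z'(3) unfolding C_def by fastforce
    let ?e = "\<lambda>j. if j = l then 1 / U l else 0"
    have "mixture G (\<lambda>j. 1 * c j + ?e j)"
    proof (rule mixture_affine[OF c(1)])
      fix t assume t: "t \<in> sparse_weights d J V T
        (B' - complex_of_real (1 / U l) \<cdot>\<^sub>m X l + complex_of_real (real T * \<delta>) \<cdot>\<^sub>m 1\<^sub>m d)"
      let ?t = "\<lambda>j. 1 * t j + ?e j"
      have "card {j. j < J \<and> ?t j \<noteq> 0} \<le> card (insert l {j. j < J \<and> t j \<noteq> 0})"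
        by (rule card_mono) auto
      also have "\<dots> \<le> Suc T" using t card_insert_le_m1[of "Suc T" "{j. j < J \<and> t j \<noteq> 0}" l]
        by (simp add: sparse_weights_def)
      finally have card: "card {j. j < J \<and> ?t j \<noteq> 0} \<le> Suc T" .
      have "B' - complex_of_real (1 / U l) \<cdot>\<^sub>m X l + complex_of_real (real T * \<delta>) \<cdot>\<^sub>m 1\<^sub>m d
          - msum d (\<lambda>j. complex_of_real (t j) \<cdot>\<^sub>m X j) {..<J}
        = B + complex_of_real (real (Suc T) * \<delta>) \<cdot>\<^sub>m 1\<^sub>m d
          - msum d (\<lambda>j. complex_of_real (?t j) \<cdot>\<^sub>m X j) {..<J}" (is "?L = ?R")
      proof (rule eq_matI)
        fix a b assume "a < dim_row ?R" "b < dim_col ?R"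
        hence ab: "a < d" "b < d" by auto
        have Xs: "(z \<cdot>\<^sub>m X j) $$ (a,b) = z * X j $$ (a,b)" if "j < J" for z j
          using X[OF that] ab by simp
        have "(\<Sum>j<J. (complex_of_real (?t j) \<cdot>\<^sub>m X j) $$ (a,b))
            = (\<Sum>j<J. complex_of_real (t j) * X j $$ (a,b) + (if j = l then complex_of_real (1 / U l) * X l $$ (a,b) else 0))"
          using Xs by (intro sum.cong) (auto simp: algebra_simps)
        also have "\<dots> = (\<Sum>j<J. complex_of_real (t j) * X j $$ (a,b)) + complex_of_real (1 / U l) * X l $$ (a,b)"
          using l by (simp add: sum.distrib)
        also have "(\<Sum>j<J. complex_of_real (t j) * X j $$ (a,b)) = (\<Sum>j<J. (complex_of_real (t j) \<cdot>\<^sub>m X j) $$ (a,b))"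
          using Xs by (intro sum.cong) auto
        finally show "?L $$ (a,b) = ?R $$ (a,b)"
          using ab X[OF l(1)] B by (simp add: B'_def algebra_simps)
      qed (use B B'' in auto)
      thus "?t \<in> G" using t card U_pos[OF l(3)]
        unfolding G_def sparse_weights_def X_def[symmetric] by auto
    qed
    thus ?thesis using c(2) by (intro exI[of _ "\<lambda>j. 1 * c j + ?e j"]) (auto simp: I_def)
  qed
  then obtain c where c: "\<And>l. l \<in> insert J I \<Longrightarrow> mixture G (c l)"
      "\<And>l i. l \<in> insert J I \<Longrightarrow> i \<in> I \<Longrightarrow> c l i = real T / C + (if i = l then 1 / U l else 0)"
    by metis
  \<comment> \<open>The scores may add up to less than \<open>C\<close>; the idle index
    \<open>J\<close> absorbs the missing probability, which keeps the average gain exactly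
    \<open>1 / C\<close>.\<close>
  define w where "w l = (if l = J then 1 - (\<Sum>j\<in>I. U j / C) else U l / C)" for l
  have J: "J \<notin> I" by (simp add: I_def)
  have sumI: "(\<Sum>j\<in>I. U j / C) \<le> 1"
  proof -
    have "(\<Sum>j\<in>I. U j) \<le> (\<Sum>j<J. U j)" using I U_nonneg by (intro sum_mono2) auto
    thus ?thesis using sumU C by (simp flip: sum_divide_distrib)
  qed
  have w: "\<And>l. l \<in> insert J I \<Longrightarrow> w l \<ge> 0"
    using sumI U_nonneg C by (auto simp: w_def I_def)
  have sw: "sum w (insert J I) = 1"
  proof -
    have "sum w I = (\<Sum>j\<in>I. U j / C)" using J by (intro sum.cong) (auto simp: w_def)
    thus ?thesis using I J by (simp add: w_def)
  qed
  have "mixture G (\<lambda>i. \<Sum>l\<in>insert J I. w l * c l i)"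
    using I w sw c(1) by (intro mixture_mixture) auto
  \<comment> \<open>Every branch contributes the average \<open>T / C\<close> of the remaining
    steps. Only branch \<open>i\<close> contributes more, namely \<open>1 / U i\<close> with
    probability \<open>U i / C\<close>.\<close>
  moreover have "(\<Sum>l\<in>insert J I. w l * c l i) = real (Suc T) / C" if i: "i \<in> I" for i
  proof -
    have "(\<Sum>l\<in>insert J I. w l * c l i)
        = (\<Sum>l\<in>insert J I. w l * (real T / C) + (if i = l then w l / U l else 0))"
      using c(2)[OF _ i] by (intro sum.cong) (auto simp: algebra_simps)
    also have "\<dots> = sum w (insert J I) * (real T / C) + w i / U i"
      unfolding sum.distrib sum_distrib_right[symmetric] using I i by simp
    also have "\<dots> = real (Suc T) / C"
      using U_pos[OF i] J i unfolding sw by (auto simp: w_def add_divide_distrib)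
    finally show ?thesis .
  qed
  ultimately show ?case unfolding G_def C_def I_def by fastforce
qed

text \<open>A walk of \<open>T = d \<kappa>\<close> steps from \<open>(d / \<epsilon>) 1\<close>,
  which has potential \<open>\<epsilon>\<close>, ends below
  \<open>d / \<epsilon> + T \<delta>\<close>; rescaling this to 1 gives the rate \<open>T / ((1 /
  \<delta> + \<epsilon>) (T \<delta> + d / \<epsilon>))\<close>. By Cauchy-Schwarz the denominator
  is at least \<open>(sqrt T + sqrt d)\<^sup>2\<close>, with equality for the choice
  \<open>\<epsilon> = 1\<close>, \<open>\<delta> = 1 / sqrt \<kappa>\<close> made here.\<close>

lemma sparse_weights_uniform_mixture:
  assumes d: "d \<ge> 1" and V: "\<And>j. j < J \<Longrightarrow> V j \<in> carrier_mat d 1"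
    and one: "msum d (\<lambda>j. V j * adj (V j)) {..<J} = 1\<^sub>m d" and \<kappa>: "\<kappa> \<ge> (1::nat)"
  shows "\<exists>c. mixture (sparse_weights d J V (d * \<kappa>) (1\<^sub>m d)) c \<and>
     (\<forall>j<J. V j \<noteq> 0\<^sub>m d 1 \<longrightarrow> c j = real \<kappa> / (1 + sqrt (real \<kappa>))\<^sup>2)"
proof -
  define s where "s = sqrt (real \<kappa>)"
  have s: "s > 0" "s * s = real \<kappa>" using \<kappa> by (auto simp: s_def)
  \<comment> \<open>The final height of the barrier, \<open>d + d \<kappa> / s\<close> with
    \<open>\<kappa> = s\<^sup>2\<close>.\<close>
  define L where "L = real d * (1 + s)"
  have L: "L > 0" using d s by (simp add: L_def)
  define Z :: "complex mat" where "Z = complex_of_real (1 / real d) \<cdot>\<^sub>m 1\<^sub>m d"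
  define B :: "complex mat" where "B = complex_of_real (real d) \<cdot>\<^sub>m 1\<^sub>m d"
  have "psd d Z" unfolding Z_def by (intro psd_smult psd_one) simp
  moreover have "Z * B = 1\<^sub>m d"
  proof -
    have "Z * B = complex_of_real (1 / real d) \<cdot>\<^sub>m (1\<^sub>m d * B)"
      unfolding Z_def by (rule mult_smult_assoc_mat) (auto simp: B_def)
    also have "1\<^sub>m d * B = B" by (rule left_mult_one_mat) (auto simp: B_def)
    also have "complex_of_real (1 / real d) \<cdot>\<^sub>m B = 1\<^sub>m d"
      unfolding B_def using d by (intro eq_matI) auto
    finally show ?thesis .
  qed
  moreover have "Re (tr Z) \<le> 1" using d by (simp add: Z_def tr_def)
  ultimately obtain c where c: "mixture (sparse_weights d J V (d * \<kappa>)
        (B + complex_of_real (real (d * \<kappa>) * (1 / s)) \<cdot>\<^sub>m 1\<^sub>m d)) c"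
      "\<forall>j<J. V j \<noteq> 0\<^sub>m d 1 \<longrightarrow> c j = real (d * \<kappa>) / (1 / (1 / s) + 1)"
    using barrier_walk[OF d V one, of "1 / s" Z B 1 "d * \<kappa>"] s by (auto simp: B_def)
  have Beq: "B + complex_of_real (real (d * \<kappa>) * (1 / s)) \<cdot>\<^sub>m 1\<^sub>m d = complex_of_real L \<cdot>\<^sub>m 1\<^sub>m d"
  proof -
    have "real d + real (d * \<kappa>) * (1 / s) = L"
      using s(1) by (simp add: L_def s(2)[symmetric] field_simps)
    hence "complex_of_real (real d) + complex_of_real (real (d * \<kappa>) * (1 / s)) = complex_of_real L"
      by (metis of_real_add)
    thus ?thesis
      unfolding B_def add_smult_distrib_right_mat[OF one_carrier_mat, symmetric] by simp
  qed
  have "mixture (sparse_weights d J V (d * \<kappa>) (1\<^sub>m d)) (\<lambda>j. 1 / L * c j + 0)"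
  proof (rule mixture_affine[OF c(1)[unfolded Beq]])
    fix t assume t: "t \<in> sparse_weights d J V (d * \<kappa>) (complex_of_real L \<cdot>\<^sub>m 1\<^sub>m d)"
    have X: "V j * adj (V j) \<in> carrier_mat d d" if "j < J" for j
      using V[OF that] by (intro mult_carrier_mat[of _ _ 1]) auto
    have "complex_of_real (1 / L) \<cdot>\<^sub>m (complex_of_real L \<cdot>\<^sub>m 1\<^sub>m d
        - msum d (\<lambda>j. complex_of_real (t j) \<cdot>\<^sub>m (V j * adj (V j))) {..<J})
      = 1\<^sub>m d - msum d (\<lambda>j. complex_of_real (1 / L * t j + 0) \<cdot>\<^sub>m (V j * adj (V j))) {..<J}" (is "?L = ?R")
    proof (rule eq_matI)
      fix a b assume "a < dim_row ?R" "b < dim_col ?R"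
      hence ab: "a < d" "b < d" by auto
      have "(\<Sum>j<J. (complex_of_real (1 / L * t j + 0) \<cdot>\<^sub>m (V j * adj (V j))) $$ (a,b))
         = (\<Sum>j<J. complex_of_real (1 / L) * (complex_of_real (t j) \<cdot>\<^sub>m (V j * adj (V j))) $$ (a,b))"
      proof (intro sum.cong refl)
        fix j assume "j \<in> {..<J}"
        hence "(z \<cdot>\<^sub>m (V j * adj (V j))) $$ (a,b) = z * (V j * adj (V j)) $$ (a,b)" for z
          using X[of j] ab by (intro index_smult_mat) (auto simp del: index_mult_mat)
        thus "(complex_of_real (1 / L * t j + 0) \<cdot>\<^sub>m (V j * adj (V j))) $$ (a,b)
          = complex_of_real (1 / L) * (complex_of_real (t j) \<cdot>\<^sub>m (V j * adj (V j))) $$ (a,b)"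
          by simp
      qed
      thus "?L $$ (a,b) = ?R $$ (a,b)"
        using ab L by (simp add: sum_divide_distrib diff_divide_distrib)
    qed auto
    moreover have "psd d (complex_of_real (1 / L) \<cdot>\<^sub>m (complex_of_real L \<cdot>\<^sub>m 1\<^sub>m d
        - msum d (\<lambda>j. complex_of_real (t j) \<cdot>\<^sub>m (V j * adj (V j))) {..<J}))"
      using t L by (intro psd_smult) (auto simp: sparse_weights_def)
    ultimately show "(\<lambda>j. 1 / L * t j + 0) \<in> sparse_weights d J V (d * \<kappa>) (1\<^sub>m d)"
      using t L by (auto simp: sparse_weights_def)
  qed
  moreover have "1 / L * (real (d * \<kappa>) / (1 / (1 / s) + 1)) = real \<kappa> / (1 + s)\<^sup>2"
    using d by (simp add: L_def power2_eq_square add.commute[of s] mult.assoc)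
  ultimately show ?thesis using c(2) unfolding s_def
    by (intro exI[of _ "\<lambda>j. 1 / L * c j + 0"]) simp
qed

section \<open>Naimark dilation\<close>

text \<open>The projection onto the basis vector \<open>l\<close>. Between \<open>F\<close> and
  \<open>adj F\<close> it becomes the outer product of column \<open>l\<close> of \<open>F\<close>
  with itself.\<close>

definition elem_diag :: "nat \<Rightarrow> nat \<Rightarrow> complex mat" where
  "elem_diag m l = mat m m (\<lambda>(a,b). if a = l \<and> b = l then 1 else 0)"

lemma elem_diag_carrier [simp]: "elem_diag m l \<in> carrier_mat m m"
  by (simp add: elem_diag_def)

lemma adj_elem_diag [simp]: "adj (elem_diag m l) = elem_diag m l"
  by (rule eq_matI) (auto simp: elem_diag_def)

lemma mult_elem_diag_index:
  assumes "X \<in> carrier_mat p m" "a < p" "b < m" "l < m"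
  shows "(X * elem_diag m l) $$ (a,b) = (if b = l then X $$ (a,l) else 0)"
  using assms by (subst index_mult_sum[of _ p m])
    (auto simp: elem_diag_def if_distrib[of "\<lambda>x. _ * x"] cong: if_cong)

lemma sandwich_elem_diag_index:
  assumes X: "X \<in> carrier_mat p m" and "a < p" "b < p" "l < m"
  shows "(X * elem_diag m l * adj X) $$ (a,b) = X $$ (a,l) * cnj (X $$ (b,l))"
proof -
  have "(X * elem_diag m l * adj X) $$ (a,b)
      = (\<Sum>k<m. (X * elem_diag m l) $$ (a,k) * adj X $$ (k,b))"
    using assms by (intro index_mult_sum[of _ p m _ p]) auto
  also have "\<dots> = (\<Sum>k<m. if k = l then X $$ (a,l) * cnj (X $$ (b,l)) else 0)"
    using assms by (intro sum.cong) (auto simp: mult_elem_diag_index simp del: index_mult_mat(1))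
  finally show ?thesis using assms by simp
qed

lemma elem_diag_mult:
  assumes "l < m" "l' < m"
  shows "elem_diag m l * elem_diag m l' = (if l = l' then elem_diag m l else 0\<^sub>m m m)"
proof (rule eq_matI)
  fix i j assume "i < dim_row (if l = l' then elem_diag m l else 0\<^sub>m m m)"
    "j < dim_col (if l = l' then elem_diag m l else 0\<^sub>m m m)"
  hence "i < m" "j < m" by (auto simp: elem_diag_def split: if_splits)
  thus "(elem_diag m l * elem_diag m l') $$ (i,j) = (if l = l' then elem_diag m l else 0\<^sub>m m m) $$ (i,j)"
    using assms by (subst mult_elem_diag_index[OF elem_diag_carrier]) (auto simp: elem_diag_def)
qed (auto simp: elem_diag_def)

lemma psd_elem_diag: "l < m \<Longrightarrow> psd m (elem_diag m l)"
  using psd_gram[OF elem_diag_carrier, of m l] by (simp add: elem_diag_mult)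

lemma psd_one_minus_gram:
  assumes W: "W \<in> carrier_mat d m" and psd: "psd d (1\<^sub>m d - W * adj W)"
  shows "psd m (1\<^sub>m m - adj W * W)"
proof -
  \<comment> \<open>With \<open>G = W\<^sup>* W\<close>: \<open>1 - G = (1 - G)\<^sup>2 + W\<^sup>* (1 - W W\<^sup>*) W\<close>.\<close>
  define G where "G = adj W * W"
  have W': "adj W \<in> carrier_mat m d" using W by simp
  have G: "G \<in> carrier_mat m m" unfolding G_def by (rule mult_carrier_mat[OF W' W])
  have WW: "W * adj W \<in> carrier_mat d d" by (rule mult_carrier_mat[OF W W'])
  have adjG: "adj G = G" using adj_mult[OF W' W] by (simp add: G_def)
  have GG: "adj W * (W * adj W) * W = G * G"
  proof -
    have "adj W * (W * adj W) * W = adj W * W * adj W * W" using assoc_mult_mat[OF W' W W'] by simp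
    also have "\<dots> = G * G" unfolding G_def[symmetric]
      using assoc_mult_mat[OF G W' W] by (simp add: G_def)
    finally show ?thesis .
  qed
  have "adj W * (1\<^sub>m d - W * adj W) * W = G - G * G"
  proof -
    have "adj W * (1\<^sub>m d - W * adj W) = adj W * 1\<^sub>m d - adj W * (W * adj W)"
      by (rule mult_minus_distrib_mat[OF W' one_carrier_mat WW])
    also have "\<dots> * W = adj W * 1\<^sub>m d * W - adj W * (W * adj W) * W"
      by (rule minus_mult_distrib_mat[OF mult_carrier_mat[OF W' one_carrier_mat] mult_carrier_mat[OF W' WW] W])
    also have "adj W * 1\<^sub>m d * W = G" by (simp only: right_mult_one_mat[OF W'] G_def)
    finally show ?thesis unfolding GG .
  qed
  moreover have "adj (1\<^sub>m m - G) * (1\<^sub>m m - G) = 1\<^sub>m m - G - (G - G * G)"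
  proof -
    have D: "1\<^sub>m m - G \<in> carrier_mat m m" using G by (rule minus_carrier_mat)
    have "adj (1\<^sub>m m - G) = 1\<^sub>m m - G" using G by (simp add: adj_minus[OF one_carrier_mat G] adjG)
    moreover have "(1\<^sub>m m - G) * (1\<^sub>m m - G) = 1\<^sub>m m * (1\<^sub>m m - G) - G * (1\<^sub>m m - G)"
      by (rule minus_mult_distrib_mat[OF one_carrier_mat G D])
    moreover have "1\<^sub>m m * (1\<^sub>m m - G) = 1\<^sub>m m - G" by (rule left_mult_one_mat[OF D])
    moreover have "G * (1\<^sub>m m - G) = G * 1\<^sub>m m - G * G"
      by (rule mult_minus_distrib_mat[OF G one_carrier_mat G])
    moreover have "G * 1\<^sub>m m = G" using G by simp
    ultimately show ?thesis by simp
  qed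
  moreover have "1\<^sub>m m - G - (G - G * G) + (G - G * G) = 1\<^sub>m m - G"
  proof -
    have "G * G \<in> carrier_mat m m" using G by simp
    thus ?thesis using G by (intro eq_matI) (auto simp del: index_mult_mat(1))
  qed
  moreover have "psd m (adj (1\<^sub>m m - G) * (1\<^sub>m m - G) + adj W * (1\<^sub>m d - W * adj W) * W)"
    using G W by (intro psd_add psd_congruence[OF psd] psd_gram[of _ m] minus_carrier_mat) auto
  ultimately show ?thesis by (simp add: G_def)
qed

text \<open>Splits a sum along the index convention \<open>a * k + b\<close> of the tensor product
  basis.\<close>

lemma sum_lessThan_mult:
  fixes f :: "nat \<Rightarrow> 'a::comm_monoid_add"
  shows "(\<Sum>r<d * k. f r) = (\<Sum>a<d. \<Sum>b<k. f (a * k + b))"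
proof -
  have "(\<Sum>a<d. \<Sum>b<k. f (a * k + b)) = (\<Sum>a<d. sum f {a * k..<a * k + k})"
  proof (rule sum.cong[OF refl])
    fix a
    show "(\<Sum>b<k. f (a * k + b)) = sum f {a * k..<a * k + k}"
      using sum.shift_bounds_nat_ivl[of f 0 "a * k" k] by (simp add: atLeast0LessThan add.commute)
  qed
  thus ?thesis by (simp add: sum.nat_group)
qed

text \<open>Factoring the defect \<open>1 - adj W * W\<close> into outer products of vectors
  \<open>X x\<close> and stacking the rows \<open>adj (X x)\<close> onto the rows of
  \<open>W\<close> makes the columns orthonormal. The \<open>d\<close> rows of \<open>W\<close> and
  the \<open>d * k\<close> new rows fill dimension \<open>d * Suc k\<close> exactly.\<close>

lemma contraction_dilation:
  assumes W: "W \<in> carrier_mat d (d * k)" and psd: "psd d (1\<^sub>m d - W * adj W)"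
  obtains F where "F \<in> carrier_mat (d * Suc k) (d * k)" "adj F * F = 1\<^sub>m (d * k)"
    "\<And>a l. a < d \<Longrightarrow> l < d * k \<Longrightarrow> F $$ (a * Suc k, l) = W $$ (a,l)"
proof -
  define m where "m = d * k"
  have W: "W \<in> carrier_mat d m" using W by (simp add: m_def)
  obtain X where X: "\<And>j. X j \<in> carrier_mat m 1"
    "1\<^sub>m m - adj W * W = msum m (\<lambda>j. X j * adj (X j)) {..<m}"
    using psd_rank_one_decomposition[OF psd_one_minus_gram[OF W psd]] by blast
  \<comment> \<open>Ancilla index 0 of block \<open>a\<close> holds row \<open>a\<close> of
    \<open>W\<close>. Ancilla indices \<open>1..k\<close> hold the defect rows, whence the shift by
    one in \<open>r mod Suc k - 1\<close>.\<close>
  define F where "F = mat (d * Suc k) m (\<lambda>(r,l). if r mod Suc k = 0 then W $$ (r div Suc k, l)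
     else cnj (X (r div Suc k * k + (r mod Suc k - 1)) $$ (l,0)))"
  have F: "F \<in> carrier_mat (d * Suc k) m" by (simp add: F_def)
  have bound: "a * Suc k + b < d * Suc k" if "a < d" "b < Suc k" for a b
  proof -
    have "a * Suc k + b < Suc a * Suc k" using that by simp
    also have "\<dots> \<le> d * Suc k" using that by (intro mult_le_mono1) auto
    finally show ?thesis .
  qed
  have F0: "F $$ (a * Suc k, l) = W $$ (a,l)" if "a < d" "l < m" for a l
    using bound[OF that(1), of 0] that by (simp add: F_def del: mult_Suc_right)
  have FS: "F $$ (a * Suc k + Suc b, l) = cnj (X (a * k + b) $$ (l,0))" if "a < d" "b < k" "l < m" for a b l
  proof -
    have "(a * Suc k + Suc b) div Suc k = a" "(a * Suc k + Suc b) mod Suc k = Suc b"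
      using that(2) div_mult_self3[of "Suc k" a "Suc b"] mod_mult_self3[of a "Suc k" "Suc b"]
      by (simp_all only: div_less mod_less Suc_less_eq nat.distinct add_0_right not_False_eq_True)
    thus ?thesis using bound[OF that(1), of "Suc b"] that by (simp add: F_def del: mult_Suc_right)
  qed
  have "adj F * F = 1\<^sub>m m"
  proof (rule eq_matI)
    fix i j assume "i < dim_row (1\<^sub>m m :: complex mat)" "j < dim_col (1\<^sub>m m :: complex mat)"
    hence ij: "i < m" "j < m" by auto
    have "(adj F * F) $$ (i,j) = (\<Sum>r<d * Suc k. cnj (F $$ (r,i)) * F $$ (r,j))"
      using F ij by (subst index_mult_sum[of _ m "d * Suc k" _ m]) auto
    also have "\<dots> = (\<Sum>a<d. \<Sum>b<Suc k. cnj (F $$ (a * Suc k + b,i)) * F $$ (a * Suc k + b,j))"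
      by (rule sum_lessThan_mult)
    also have "\<dots> = (\<Sum>a<d. cnj (W $$ (a,i)) * W $$ (a,j)
        + (\<Sum>b<k. X (a * k + b) $$ (i,0) * cnj (X (a * k + b) $$ (j,0))))"
    proof (rule sum.cong[OF refl])
      fix a assume "a \<in> {..<d}"
      thus "(\<Sum>b<Suc k. cnj (F $$ (a * Suc k + b,i)) * F $$ (a * Suc k + b,j))
        = cnj (W $$ (a,i)) * W $$ (a,j)
        + (\<Sum>b<k. X (a * k + b) $$ (i,0) * cnj (X (a * k + b) $$ (j,0)))"
        unfolding sum.lessThan_Suc_shift using ij by (simp add: F0 FS del: mult_Suc_right add_Suc_right)
    qed
    also have "\<dots> = (adj W * W) $$ (i,j) + (\<Sum>x<m. X x $$ (i,0) * cnj (X x $$ (j,0)))"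
    proof -
      have "(adj W * W) $$ (i,j) = (\<Sum>a<d. cnj (W $$ (a,i)) * W $$ (a,j))"
        using W ij by (subst index_mult_sum[of _ m d _ m]) auto
      thus ?thesis
        unfolding sum.distrib m_def sum_lessThan_mult[of "\<lambda>x. X x $$ (i,0) * cnj (X x $$ (j,0))"] by simp
    qed
    also have "(\<Sum>x<m. X x $$ (i,0) * cnj (X x $$ (j,0))) = msum m (\<lambda>j. X j * adj (X j)) {..<m} $$ (i,j)"
      unfolding index_msum[OF ij]
    proof (rule sum.cong[OF refl])
      fix x show "X x $$ (i,0) * cnj (X x $$ (j,0)) = (X x * adj (X x)) $$ (i,j)"
        using X(1)[of x] ij by (subst index_mult_sum[of _ m 1 _ m]) auto
    qed
    also have "\<dots> = (1\<^sub>m m - adj W * W) $$ (i,j)" by (simp only: X(2))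
    finally show "(adj F * F) $$ (i,j) = 1\<^sub>m m $$ (i,j)"
      using W ij by (simp del: index_mult_mat(1))
  qed (use F in auto)
  thus ?thesis using that[of F] F F0 by (simp add: m_def)
qed

text \<open>The columns of \<open>F\<close> are orthonormal, so their outer products are orthogonal
  rank-one projections with sum \<open>F * adj F\<close>; the last effect is the projection onto the
  orthogonal complement of its range.\<close>

lemma isometry_projective:
  assumes F: "F \<in> carrier_mat D m" and FF: "adj F * F = 1\<^sub>m m"
  shows "projective D (Suc m) (\<lambda>j. if j < m then F * elem_diag m j * adj F else 1\<^sub>m D - F * adj F)"
    (is "projective _ _ ?P")
proof -
  have F': "adj F \<in> carrier_mat m D" using F by simp
  define Q where "Q = F * adj F"
  have Q: "Q \<in> carrier_mat D D" unfolding Q_def by (rule mult_carrier_mat[OF F F'])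
  \<comment> \<open>The inner factor \<open>adj F * F\<close> cancels, so conjugation by
    \<open>F\<close> is multiplicative. All product relations reduce to those of
    \<open>elem_diag\<close> and the identity.\<close>
  have P_mult: "(F * A * adj F) * (F * B * adj F) = F * (A * B) * adj F"
    if A: "A \<in> carrier_mat m m" and B: "B \<in> carrier_mat m m" for A B
  proof -
    have FA: "F * A \<in> carrier_mat D m" and FB: "F * B \<in> carrier_mat D m" using F A B by auto
    have "(F * A * adj F) * (F * B * adj F) = F * A * (adj F * (F * B * adj F))"
      by (rule assoc_mult_mat[OF FA F' mult_carrier_mat[OF FB F']])
    also have "adj F * (F * B * adj F) = adj F * (F * B) * adj F"
      by (rule assoc_mult_mat[OF F' FB F', symmetric])
    also have "adj F * (F * B) = adj F * F * B" by (rule assoc_mult_mat[OF F' F B, symmetric])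
    also have "\<dots> = B" using B by (simp add: FF)
    also have "F * A * (B * adj F) = F * A * B * adj F" by (rule assoc_mult_mat[OF FA B F', symmetric])
    also have "F * A * B = F * (A * B)" by (rule assoc_mult_mat[OF F A B])
    finally show ?thesis .
  qed
  have Q1: "Q = F * 1\<^sub>m m * adj F" using F by (simp add: Q_def)
  have QQ: "Q * Q = Q" unfolding Q1 using P_mult[of "1\<^sub>m m" "1\<^sub>m m"] by simp
  have PQ: "(F * A * adj F) * Q = F * A * adj F" if "A \<in> carrier_mat m m" for A
    unfolding Q1 using P_mult[OF that, of "1\<^sub>m m"] that by simp
  have QP: "Q * (F * A * adj F) = F * A * adj F" if "A \<in> carrier_mat m m" for A
    unfolding Q1 using P_mult[OF _ that, of "1\<^sub>m m"] that by simp
  have D: "1\<^sub>m D - Q \<in> carrier_mat D D" using Q by (rule minus_carrier_mat)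
  have adjQ: "adj Q = Q" using adj_mult[OF F F'] by (simp add: Q_def)
  have adjD: "adj (1\<^sub>m D - Q) = 1\<^sub>m D - Q" using adj_minus[OF one_carrier_mat Q] by (simp add: adjQ)
  have DR: "X * (1\<^sub>m D - Q) = X - X * Q" if "X \<in> carrier_mat D D" for X
    using mult_minus_distrib_mat[OF that one_carrier_mat Q] that by simp
  have DL: "(1\<^sub>m D - Q) * X = X - Q * X" if "X \<in> carrier_mat D D" for X
    using minus_mult_distrib_mat[OF one_carrier_mat Q that] that by simp
  have DQ: "Q * (1\<^sub>m D - Q) = 0\<^sub>m D D" using DR[OF Q] Q by (simp add: QQ)
  have DD: "(1\<^sub>m D - Q) * (1\<^sub>m D - Q) = 1\<^sub>m D - Q"
    unfolding DL[OF D] DQ using Q by (intro eq_matI) auto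
  have Pc: "F * elem_diag m j * adj F \<in> carrier_mat D D" for j
    using F F' by (intro mult_carrier_mat[of _ _ m]) auto
  have "psd D (?P j)" for j
    using psd_congruence[OF psd_elem_diag, of j m "adj F" D] F psd_gram[OF D]
    by (simp add: adjD DD Q_def[symmetric])
  moreover have "msum D ?P {..<Suc m} = 1\<^sub>m D"
  proof (rule eq_matI)
    fix a b assume "a < dim_row (1\<^sub>m D :: complex mat)" "b < dim_col (1\<^sub>m D :: complex mat)"
    hence ab: "a < D" "b < D" by auto
    have "(\<Sum>j<m. ?P j $$ (a,b)) = (\<Sum>j<m. F $$ (a,j) * cnj (F $$ (b,j)))"
      using ab by (intro sum.cong refl) (simp only: lessThan_iff if_True sandwich_elem_diag_index[OF F])
    also have "\<dots> = Q $$ (a,b)"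
      unfolding Q_def using F ab by (subst index_mult_sum[of _ D m _ D]) auto
    finally show "msum D ?P {..<Suc m} $$ (a,b) = 1\<^sub>m D $$ (a,b)"
      using ab Q by (simp add: Q_def[symmetric])
  qed auto
  moreover have "?P i * ?P j = (if i = j then ?P i else 0\<^sub>m D D)" if ij: "i < Suc m" "j < Suc m" for i j
  proof -
    consider "i < m" "j < m" | "i < m" "j = m" | "i = m" "j < m" | "i = m" "j = m"
      using ij by linarith
    thus ?thesis
    proof cases
      case 1
      have "?P i * ?P j = F * (elem_diag m i * elem_diag m j) * adj F" using 1 by (simp only: P_mult elem_diag_carrier if_True)
      thus ?thesis using 1 F F' by (simp add: elem_diag_mult)
    next
      case 2
      thus ?thesis using DR[OF Pc] PQ[OF elem_diag_carrier, of i] Pc[of i] by (simp only: Q_def[symmetric]) auto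
    next
      case 3
      thus ?thesis using DL[OF Pc] QP[OF elem_diag_carrier, of j] Pc[of j] by (simp only: Q_def[symmetric]) auto
    next
      case 4
      thus ?thesis using DD by (simp add: Q_def[symmetric])
    qed
  qed
  ultimately show ?thesis by (simp add: projective_def povm_def del: lessThan_Suc)
qed

lemma embed_unit:
  assumes "r < d * Suc k" "a < d"
  shows "embed d (Suc k) (unit_vec (Suc k) 0) $$ (r,a) = (if r = a * Suc k then 1 else 0)"
proof -
  have "r div Suc k = a \<and> r mod Suc k = 0 \<longleftrightarrow> r = a * Suc k"
    by (metis add.right_neutral div_mult_mod_eq mod_mult_self2_is_0 nonzero_mult_div_cancel_right nat.distinct(1))
  thus ?thesis using assms by (auto simp: embed_def unit_vec_def)
qed

text \<open>The ancilla starts in its basis vector 0, so \<open>adj E\<close> selects exactly the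
  rows of the dilation \<open>F\<close> in which \<open>W\<close> was stored. Hence
  \<open>adj E * F = W\<close>, and compressing \<open>F A adj F\<close> gives
  \<open>W A adj W\<close>. The ancilla dimension is \<open>Suc k\<close>: one level for
  \<open>W\<close> and \<open>k\<close> for the defect.\<close>

lemma naimark_dilation:
  assumes W: "W \<in> carrier_mat d (d * k)" and psd: "psd d (1\<^sub>m d - W * adj W)"
  defines "E \<equiv> embed d (Suc k) (unit_vec (Suc k) 0)" and "m \<equiv> d * k"
  obtains P where "projective (d * Suc k) (Suc m) P"
    "\<And>j. j < m \<Longrightarrow> adj E * P j * E = W * elem_diag m j * adj W"
    "adj E * P m * E = 1\<^sub>m d - W * adj W"
proof -
  define D where "D = d * Suc k"
  obtain F where F: "F \<in> carrier_mat D m" "adj F * F = 1\<^sub>m m"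
    "\<And>a l. a < d \<Longrightarrow> l < m \<Longrightarrow> F $$ (a * Suc k, l) = W $$ (a,l)"
    using contraction_dilation[OF W psd] unfolding m_def D_def by blast
  have W: "W \<in> carrier_mat d m" using W by (simp add: m_def)
  have E: "E \<in> carrier_mat D d" by (simp add: E_def embed_def D_def)
  have E': "adj E \<in> carrier_mat d D" and F': "adj F \<in> carrier_mat m D" using E F by auto
  have lt: "a * Suc k < D" if "a < d" for a using that unfolding D_def by (intro mult_less_mono1) auto
  have E_nth: "E $$ (r,a) = (if r = a * Suc k then 1 else 0)" if "r < D" "a < d" for r a
    using embed_unit that unfolding E_def D_def by blast
  \<comment> \<open>Multiplication by \<open>adj E\<close> from the left is row selection.\<close>
  have E_mult: "adj E * X = mat d p (\<lambda>(a,l). X $$ (a * Suc k, l))" if X: "X \<in> carrier_mat D p" for X p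
  proof (rule eq_matI)
    fix a l assume "a < dim_row (mat d p (\<lambda>(a,l). X $$ (a * Suc k, l)))"
      "l < dim_col (mat d p (\<lambda>(a,l). X $$ (a * Suc k, l)))"
    hence al: "a < d" "l < p" by auto
    have "(adj E * X) $$ (a,l) = (\<Sum>r<D. cnj (E $$ (r,a)) * X $$ (r,l))"
      using E X al by (subst index_mult_sum[of _ d D _ p]) auto
    also have "\<dots> = (\<Sum>r<D. if r = a * Suc k then X $$ (r,l) else 0)"
      using al by (intro sum.cong) (auto simp: E_nth)
    also have "\<dots> = X $$ (a * Suc k, l)" using lt[OF al(1)] by (simp del: mult_Suc_right)
    finally show "(adj E * X) $$ (a,l) = mat d p (\<lambda>(a,l). X $$ (a * Suc k, l)) $$ (a,l)"
      using al by simp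
  qed (use E X in auto)
  have EF: "adj E * F = W"
    unfolding E_mult[OF F(1)] using W F(3) by (intro eq_matI) auto
  have EE: "adj E * E = 1\<^sub>m d"
    unfolding E_mult[OF E] by (intro eq_matI) (auto simp: E_nth lt simp del: mult_Suc_right)
  have FE: "adj F * E = adj W" using arg_cong[OF EF, of adj] adj_mult[OF E' F(1)] by simp
  define P where "P j = (if j < m then F * elem_diag m j * adj F else 1\<^sub>m D - F * adj F)" for j
  have conj: "adj E * (F * A * adj F) * E = W * A * adj W" if A: "A \<in> carrier_mat m m" for A
  proof -
    have FA: "F * A \<in> carrier_mat D m" using F A by simp
    have "adj E * (F * A * adj F) = adj E * (F * A) * adj F" by (rule assoc_mult_mat[OF E' FA F', symmetric])
    also have "adj E * (F * A) = W * A" using assoc_mult_mat[OF E' F(1) A] by (simp add: EF)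
    also have "W * A * adj F * E = W * A * adj W"
      using assoc_mult_mat[of "W * A" d m "adj F" D E d] W A F' E by (simp add: FE)
    finally show ?thesis .
  qed
  have "projective D (Suc m) P"
    using isometry_projective[OF F(1,2)] unfolding P_def[abs_def] .
  moreover have "adj E * P j * E = W * elem_diag m j * adj W" if "j < m" for j
    using conj[of "elem_diag m j"] that by (simp add: P_def)
  moreover have "adj E * P m * E = 1\<^sub>m d - W * adj W"
  proof -
    have FF: "F * adj F \<in> carrier_mat D D" by (rule mult_carrier_mat[OF F(1) F'])
    have "adj E * P m = adj E * 1\<^sub>m D - adj E * (F * adj F)"
      unfolding P_def using mult_minus_distrib_mat[OF E' one_carrier_mat FF] by simp
    also have "\<dots> * E = adj E * 1\<^sub>m D * E - adj E * (F * adj F) * E"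
      by (rule minus_mult_distrib_mat[OF mult_carrier_mat[OF E' one_carrier_mat] mult_carrier_mat[OF E' FF] E])
    also have "adj E * 1\<^sub>m D = adj E" by (rule right_mult_one_mat[OF E'])
    also have "adj E * (F * adj F) * E = W * adj W"
      using conj[of "1\<^sub>m m"] F(1) W by simp
    finally show ?thesis by (simp add: EE)
  qed
  ultimately show ?thesis using that[of P] by (simp add: D_def)
qed

section \<open>Simulation of a POVM\<close>

text \<open>The selected pieces, scaled by the roots of their weights, become the columns of a
  contraction \<open>W\<close> with \<open>d * k\<close> columns, to which the dilation applies. The
  post-processing is deterministic: a column is sent to the label of its piece, the complement to
  the failure outcome \<open>n\<close>. At most one label per selected piece, plus failure, has a
  nonzero effect.\<close>

lemma sparse_weights_simulation:
  assumes V: "\<And>j. j < J \<Longrightarrow> V j \<in> carrier_mat d 1" and lab: "\<And>j. j < J \<Longrightarrow> lab j < n"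
    and t: "t \<in> sparse_weights d J V (d * k) (1\<^sub>m d)"
  defines "X \<equiv> \<lambda>j. complex_of_real (t j) \<cdot>\<^sub>m (V j * adj (V j))"
  defines "N \<equiv> \<lambda>i. if i < n then msum d X {j. j < J \<and> lab j = i} else 1\<^sub>m d - msum d X {..<J}"
  shows "povm d (Suc n) N" "implementable d (Suc k) (Suc n) N"
    "card {i. i \<le> n \<and> N i \<noteq> 0\<^sub>m d d} \<le> d * k + 1"
proof -
  define S where "S = {j. j < J \<and> t j \<noteq> 0}"
  define m where "m = d * k"
  have t_nonneg: "\<And>j. t j \<ge> 0" and card_S: "card S \<le> m"
    and psd_rest: "psd d (1\<^sub>m d - msum d X {..<J})"
    using t by (auto simp: sparse_weights_def S_def m_def X_def)
  have S: "finite S" by (simp add: S_def)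
  have X_nth: "X j $$ (a,b) = complex_of_real (t j) * (V j $$ (a,0) * cnj (V j $$ (b,0)))"
    if "j < J" "a < d" "b < d" for j a b
  proof -
    have "(V j * adj (V j)) $$ (a,b) = V j $$ (a,0) * cnj (V j $$ (b,0))"
      using V[OF that(1)] that by (subst index_mult_sum[of _ d 1 _ d]) auto
    thus ?thesis using V[OF that(1)] that by (simp add: X_def del: index_mult_mat(1))
  qed
  have psd_X: "psd d (X j)" if "j < J" for j
    unfolding X_def using that by (intro psd_smult psd_gram'[OF V] t_nonneg)
  show "povm d (Suc n) N"
    unfolding povm_def
  proof (intro conjI allI impI)
    show "psd d (N i)" for i using psd_rest by (auto simp: N_def intro!: psd_msum psd_X)
    show "msum d N {..<Suc n} = 1\<^sub>m d"
    proof (rule eq_matI)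
      fix a b assume "a < dim_row (1\<^sub>m d :: complex mat)" "b < dim_col (1\<^sub>m d :: complex mat)"
      hence ab: "a < d" "b < d" by auto
      have "(\<Sum>i<n. N i $$ (a,b)) = (\<Sum>i<n. \<Sum>j | j \<in> {..<J} \<and> lab j = i. X j $$ (a,b))"
        using ab by (simp add: N_def)
      also have "\<dots> = (\<Sum>j<J. X j $$ (a,b))"
        using lab by (intro sum.group) auto
      finally show "msum d N {..<Suc n} $$ (a,b) = 1\<^sub>m d $$ (a,b)"
        using ab by (simp add: N_def)
    qed auto
  qed
  show "card {i. i \<le> n \<and> N i \<noteq> 0\<^sub>m d d} \<le> d * k + 1"
  proof -
    have "{i. i \<le> n \<and> N i \<noteq> 0\<^sub>m d d} \<subseteq> insert n (lab ` S)"
    proof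
      fix i assume i: "i \<in> {i. i \<le> n \<and> N i \<noteq> 0\<^sub>m d d}"
      show "i \<in> insert n (lab ` S)"
      proof (rule ccontr)
        assume not: "i \<notin> insert n (lab ` S)"
        hence "i < n" using i by auto
        moreover have "X j $$ (a,b) = 0" if "j < J" "lab j = i" "a < d" "b < d" for j a b
          using not that X_nth[of j a b] by (auto simp: S_def)
        ultimately have "N i = 0\<^sub>m d d" by (intro eq_matI) (auto simp: N_def intro!: sum.neutral)
        thus False using i by simp
      qed
    qed
    hence "card {i. i \<le> n \<and> N i \<noteq> 0\<^sub>m d d} \<le> card (insert n (lab ` S))"
      using S by (intro card_mono) auto
    also have "\<dots> \<le> card (lab ` S) + 1" using S by (simp add: card_insert_if)
    also have "\<dots> \<le> card S + 1" using S by (simp add: card_image_le)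
    finally show ?thesis using card_S by (simp add: m_def)
  qed
  obtain h where h: "bij_betw h {..<card S} S"
    using ex_bij_betw_nat_finite[OF S] by (auto simp: atLeast0LessThan)
  have hS: "h l \<in> S" if "l < card S" for l using bij_betwE[OF h] that by auto
  \<comment> \<open>If fewer than \<open>m\<close> pieces are selected, the remaining columns are
    zero.\<close>
  define W where "W = mat d m (\<lambda>(a,l). if l < card S
     then complex_of_real (sqrt (t (h l))) * V (h l) $$ (a,0) else 0)"
  have W: "W \<in> carrier_mat d m" by (simp add: W_def)
  have W_nth: "W $$ (a,l) * cnj (W $$ (b,l)) = (if l < card S then X (h l) $$ (a,b) else 0)"
    if "a < d" "b < d" "l < m" for a b l
  proof (cases "l < card S")
    case True
    hence "h l < J" using hS by (auto simp: S_def)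
    moreover have "complex_of_real (sqrt (t (h l))) * complex_of_real (sqrt (t (h l))) = complex_of_real (t (h l))"
      using t_nonneg[of "h l"] by (simp flip: of_real_mult)
    ultimately show ?thesis using that True by (simp add: W_def X_nth mult_ac)
  qed (use that in \<open>auto simp: W_def\<close>)
  \<comment> \<open>Passes from columns to pieces along \<open>h\<close>. The predicate
    \<open>P\<close> serves both the sum over all pieces and the sum over a single label.\<close>
  have sum_h: "(\<Sum>l<m. if l < card S \<and> P (lab (h l)) then X (h l) $$ (a,b) else 0)
      = (\<Sum>j | j < J \<and> P (lab j). X j $$ (a,b))" if ab: "a < d" "b < d" for a b P
  proof -
    have "(\<Sum>l<m. if l < card S \<and> P (lab (h l)) then X (h l) $$ (a,b) else 0)
        = (\<Sum>l<card S. if P (lab (h l)) then X (h l) $$ (a,b) else 0)"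
      using card_S by (intro sum.mono_neutral_cong_right) auto
    also have "\<dots> = (\<Sum>j\<in>S. if P (lab j) then X j $$ (a,b) else 0)"
      by (rule sum.reindex_bij_betw[OF h])
    also have "\<dots> = (\<Sum>j<J. if P (lab j) then X j $$ (a,b) else 0)"
      using ab by (intro sum.mono_neutral_left) (auto simp: S_def X_nth)
    also have "\<dots> = (\<Sum>j | j < J \<and> P (lab j). X j $$ (a,b))"
      by (simp add: sum.If_cases lessThan_def Collect_conj_eq)
    finally show ?thesis .
  qed
  have WW: "W * adj W = msum d X {..<J}"
  proof (rule eq_matI)
    fix a b assume "a < dim_row (msum d X {..<J})" "b < dim_col (msum d X {..<J})"
    hence ab: "a < d" "b < d" by auto
    have "(W * adj W) $$ (a,b) = (\<Sum>l<m. W $$ (a,l) * cnj (W $$ (b,l)))"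
      using W ab by (subst index_mult_sum[of _ d m _ d]) auto
    also have "\<dots> = (\<Sum>l<m. if l < card S \<and> True then X (h l) $$ (a,b) else 0)"
      using W_nth[OF ab] by simp
    also have "\<dots> = (\<Sum>j | j < J \<and> True. X j $$ (a,b))" using sum_h[OF ab, of "\<lambda>_. True"] .
    finally show "(W * adj W) $$ (a,b) = msum d X {..<J} $$ (a,b)"
      using ab by (simp add: lessThan_def)
  qed (use W in auto)
  define E where "E = embed d (Suc k) (unit_vec (Suc k) 0)"
  obtain P where P: "projective (d * Suc k) (Suc m) P"
    "\<And>j. j < m \<Longrightarrow> adj E * P j * E = W * elem_diag m j * adj W"
    "adj E * P m * E = 1\<^sub>m d - W * adj W"
    using naimark_dilation[of W d k] W psd_rest unfolding WW m_def E_def by metis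
  \<comment> \<open>Padding columns are also sent to failure; their compressed effects are zero, so
    they contribute nothing. The complement has index \<open>m\<close>, which is not below
    \<open>card S\<close> either.\<close>
  define g where "g j = (if j < card S then lab (h j) else n)" for j
  have g_le: "g j \<le> n" for j using hS lab by (auto simp: g_def S_def intro: less_imp_le)
  define q where "q i j = (if i = g j then 1 else 0 :: real)" for i j
  have N_eq: "N i = msum d (\<lambda>j. complex_of_real (q i j) \<cdot>\<^sub>m (adj E * P j * E)) {..<Suc m}" if i: "i < Suc n" for i
  proof (rule eq_matI)
    let ?R = "msum d (\<lambda>j. complex_of_real (q i j) \<cdot>\<^sub>m (adj E * P j * E)) {..<Suc m}"
    fix a b assume "a < dim_row ?R" "b < dim_col ?R"
    hence ab: "a < d" "b < d" by auto
    have inner: "(complex_of_real (q i j) \<cdot>\<^sub>m (adj E * P j * E)) $$ (a,b)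
        = (if j < card S \<and> lab (h j) = i then X (h j) $$ (a,b) else 0)" if j: "j < m" for j
    proof -
      have "W * elem_diag m j * adj W \<in> carrier_mat d d"
        using W by (intro mult_carrier_mat[of _ _ m]) auto
      hence "(complex_of_real (q i j) \<cdot>\<^sub>m (adj E * P j * E)) $$ (a,b)
          = complex_of_real (q i j) * (W * elem_diag m j * adj W) $$ (a,b)"
        unfolding P(2)[OF j] using ab by (intro index_smult_mat) (auto simp del: index_mult_mat)
      also have "\<dots> = complex_of_real (q i j) * (W $$ (a,j) * cnj (W $$ (b,j)))"
        using sandwich_elem_diag_index[OF W ab j] by simp
      finally show ?thesis using W_nth[OF ab j] by (auto simp: q_def g_def)
    qed
    have "(\<Sum>j<m. (complex_of_real (q i j) \<cdot>\<^sub>m (adj E * P j * E)) $$ (a,b))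
        = (\<Sum>j<m. if j < card S \<and> lab (h j) = i then X (h j) $$ (a,b) else 0)"
      using inner by (intro sum.cong) auto
    also have "\<dots> = (\<Sum>j | j < J \<and> lab j = i. X j $$ (a,b))" using sum_h[OF ab, of "\<lambda>x. x = i"] .
    finally have 1: "(\<Sum>j<m. (complex_of_real (q i j) \<cdot>\<^sub>m (adj E * P j * E)) $$ (a,b))
        = (\<Sum>j | j < J \<and> lab j = i. X j $$ (a,b))" .
    have 2: "(complex_of_real (q i m) \<cdot>\<^sub>m (adj E * P m * E)) $$ (a,b)
        = (if i = n then (1\<^sub>m d - msum d X {..<J}) $$ (a,b) else 0)"
    proof -
      have "g m = n" using card_S by (simp add: g_def)
      thus ?thesis unfolding P(3) WW using ab by (auto simp: q_def)
    qed
    show "N i $$ (a,b) = ?R $$ (a,b)"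
    proof (cases "i = n")
      case True
      have "{j. j < J \<and> lab j = i} = {}" using lab True by force
      hence "(\<Sum>j | j < J \<and> lab j = i. X j $$ (a,b)) = 0" by (simp only: sum.empty)
      hence "?R $$ (a,b) = (1\<^sub>m d - msum d X {..<J}) $$ (a,b)"
        unfolding index_msum[OF ab] sum.lessThan_Suc 1 2 using True by (simp only: add_0 if_True simp_thms)
      thus ?thesis using True by (simp add: N_def)
    next
      case False
      hence "i < n" using i by simp
      thus ?thesis unfolding index_msum[OF ab] sum.lessThan_Suc 1 2 using ab by (simp add: N_def)
    qed
  qed (auto simp: N_def)
  show "implementable d (Suc k) (Suc n) N"
    unfolding implementable_def
  proof (intro exI conjI)
    show "unit_vec (Suc k) 0 \<in> carrier_vec (Suc k)" by simp
    show "unit_vec (Suc k) 0 \<bullet>c unit_vec (Suc k) 0 = (1::complex)"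
      by (simp add: cscalar_prod_self[of _ "Suc k"] sum.lessThan_Suc_shift unit_vec_def del: sum.lessThan_Suc)
    show "projective (d * Suc k) (Suc m) P" by (rule P(1))
    show "\<forall>i<Suc n. \<forall>j<Suc m. 0 \<le> q i j" by (simp add: q_def)
    show "\<forall>j<Suc m. (\<Sum>i<Suc n. q i j) = 1" using g_le by (simp add: q_def less_Suc_eq_le del: sum.lessThan_Suc)
    show "\<forall>i<Suc n. N i = msum d (\<lambda>j. complex_of_real (q i j) \<cdot>\<^sub>m
        (adj (embed d (Suc k) (unit_vec (Suc k) 0)) * P j * embed d (Suc k) (unit_vec (Suc k) 0))) {..<Suc m}"
      using N_eq unfolding E_def by blast
  qed
qed

text \<open>Each effect splits into \<open>d\<close> rank-one pieces. Piece \<open>j\<close> of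
  effect \<open>i\<close> is numbered \<open>i * d + j\<close>, so the label of a piece is its
  number divided by \<open>d\<close>.\<close>

lemma povm_rank_one_refinement:
  assumes "povm d n M" and d: "d \<ge> 1"
  obtains V where "\<And>l. V l \<in> carrier_mat d 1"
    "\<And>i. i < n \<Longrightarrow> M i = msum d (\<lambda>l. V l * adj (V l)) {l. l < n * d \<and> l div d = i}"
    "msum d (\<lambda>l. V l * adj (V l)) {..<n * d} = 1\<^sub>m d"
proof -
  have "\<forall>i. \<exists>V. (\<forall>j. V j \<in> carrier_mat d 1) \<and> (i < n \<longrightarrow> M i = msum d (\<lambda>j. V j * adj (V j)) {..<d})"
  proof
    fix i
    show "\<exists>V. (\<forall>j. V j \<in> carrier_mat d 1) \<and> (i < n \<longrightarrow> M i = msum d (\<lambda>j. V j * adj (V j)) {..<d})"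
    proof (cases "i < n")
      case True
      hence "psd d (M i)" using assms(1) by (simp add: povm_def)
      thus ?thesis by (metis psd_rank_one_decomposition)
    \<comment> \<open>Zero vectors outside the outcome range make the family total, as the choice of
      \<open>V\<close> for all \<open>i\<close> requires.\<close>
    qed (auto intro!: exI[of _ "\<lambda>_. 0\<^sub>m d 1"])
  qed
  then obtain V where V: "\<And>i j. V i j \<in> carrier_mat d 1"
    "\<And>i. i < n \<Longrightarrow> M i = msum d (\<lambda>j. V i j * adj (V i j)) {..<d}"
    by metis
  define U where "U l = V (l div d) (l mod d)" for l
  have Ui: "M i = msum d (\<lambda>l. U l * adj (U l)) {l. l < n * d \<and> l div d = i}" if i: "i < n" for i
  proof -
    have "bij_betw (\<lambda>j. i * d + j) {..<d} {l. l < n * d \<and> l div d = i}"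
    proof (rule bij_betw_byWitness[where f' = "\<lambda>l. l mod d"])
      show "\<forall>a'\<in>{l. l < n * d \<and> l div d = i}. i * d + a' mod d = a'"
        using div_mult_mod_eq by auto
      show "(\<lambda>j. i * d + j) ` {..<d} \<subseteq> {l. l < n * d \<and> l div d = i}"
      proof safe
        fix j assume j: "j < d"
        have "i * d + j < Suc i * d" using j by simp
        also have "\<dots> \<le> n * d" using i by (intro mult_le_mono1) auto
        finally show "i * d + j < n * d" .
        show "(i * d + j) div d = i" using j by simp
      qed
    qed (use d in auto)
    hence "(\<Sum>j<d. f (i * d + j)) = sum f {l. l < n * d \<and> l div d = i}" for f :: "nat \<Rightarrow> complex"
      by (rule sum.reindex_bij_betw)
    hence "(\<Sum>j<d. (V i j * adj (V i j)) $$ (a,b))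
       = (\<Sum>l | l < n * d \<and> l div d = i. (U l * adj (U l)) $$ (a,b))" for a b
      using d by (simp add: U_def del: index_mult_mat flip: \<open>\<And>f. (\<Sum>j<d. f (i * d + j)) = _\<close>)
    thus ?thesis unfolding V(2)[OF i] msum_def by simp
  qed
  moreover have "msum d (\<lambda>l. U l * adj (U l)) {..<n * d} = 1\<^sub>m d"
  proof -
    have "msum d (\<lambda>l. U l * adj (U l)) {..<n * d} = msum d M {..<n}"
    proof (rule eq_matI)
      fix a b assume "a < dim_row (msum d M {..<n})" "b < dim_col (msum d M {..<n})"
      hence ab: "a < d" "b < d" by auto
      have "(\<Sum>i<n. M i $$ (a,b))
          = (\<Sum>i<n. \<Sum>l | l \<in> {..<n * d} \<and> l div d = i. (U l * adj (U l)) $$ (a,b))"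
        using ab by (intro sum.cong refl) (simp add: Ui)
      also have "\<dots> = (\<Sum>l<n * d. (U l * adj (U l)) $$ (a,b))"
        using d by (intro sum.group) (auto simp: less_mult_imp_div_less)
      finally show "msum d (\<lambda>l. U l * adj (U l)) {..<n * d} $$ (a,b) = msum d M {..<n} $$ (a,b)"
        using ab by (simp del: index_mult_mat)
    qed auto
    thus ?thesis using assms(1) by (simp add: povm_def)
  qed
  ultimately show ?thesis using that[of U] V(1) by (simp add: U_def)
qed

text \<open>Effects depend linearly on the weights, and every nonzero piece has mean weight
  \<open>q\<close>. So the averaged effects are \<open>q\<close> times those of \<open>M\<close>,
  and averaging \<open>1\<close> minus their sum gives \<open>1 - q\<close> times the identity for
  failure.\<close>

lemma povm_postselected_simulation:
  assumes d: "d \<ge> 1" and \<kappa>: "\<kappa> \<ge> 1" and M: "povm d n M"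
  defines "q \<equiv> real \<kappa> / (1 + sqrt (real \<kappa>))\<^sup>2"
  shows "\<exists>r p N. prob_dist r p \<and>
     (\<forall>b<r. povm d (Suc n) (N b) \<and> implementable d (Suc \<kappa>) (Suc n) (N b) \<and>
            card {i. i \<le> n \<and> N b i \<noteq> 0\<^sub>m d d} \<le> d * \<kappa> + 1) \<and>
     (\<forall>i\<le>n. msum d (\<lambda>b. complex_of_real (p b) \<cdot>\<^sub>m N b i) {..<r} = postsel d n q M i)"
proof -
  define J where "J = n * d"
  obtain V where V: "\<And>l. V l \<in> carrier_mat d 1"
    "\<And>i. i < n \<Longrightarrow> M i = msum d (\<lambda>l. V l * adj (V l)) {l. l < J \<and> l div d = i}"
    "msum d (\<lambda>l. V l * adj (V l)) {..<J} = 1\<^sub>m d"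
    by (rule povm_rank_one_refinement[OF M d, folded J_def]) blast
  have lab: "j div d < n" if "j < J" for j
    using that by (simp add: J_def less_mult_imp_div_less)
  obtain c where "mixture (sparse_weights d J V (d * \<kappa>) (1\<^sub>m d)) c"
    and c: "\<And>j. j < J \<Longrightarrow> V j \<noteq> 0\<^sub>m d 1 \<Longrightarrow> c j = q"
    using sparse_weights_uniform_mixture[OF d _ V(3) \<kappa>] V(1) unfolding q_def by blast
  then obtain r p t where p: "prob_dist r p" and t: "\<And>b. b < r \<Longrightarrow> t b \<in> sparse_weights d J V (d * \<kappa>) (1\<^sub>m d)"
    and ct: "\<And>j. c j = (\<Sum>b<r. p b * t b j)"
    unfolding mixture_def by blast
  define X where "X b j = complex_of_real (t b j) \<cdot>\<^sub>m (V j * adj (V j))" for b j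
  define N where "N b i = (if i < n then msum d (X b) {j. j < J \<and> j div d = i}
     else 1\<^sub>m d - msum d (X b) {..<J})" for b i
  have VV: "V j * adj (V j) \<in> carrier_mat d d" for j
    using V(1)[of j] by (intro mult_carrier_mat[of _ _ 1]) auto
  have X_nth: "X b j $$ (u,v) = complex_of_real (t b j) * (V j * adj (V j)) $$ (u,v)"
    if "u < d" "v < d" for b j u v
    unfolding X_def using that VV[of j] by (intro index_smult_mat) (auto simp del: index_mult_mat)
  have avg: "(\<Sum>b<r. complex_of_real (p b) * (\<Sum>j\<in>A. X b j $$ (u,v)))
      = complex_of_real q * (\<Sum>j\<in>A. (V j * adj (V j)) $$ (u,v))"
    if uv: "u < d" "v < d" and A: "A \<subseteq> {..<J}" for u v A
  proof -
    have "(\<Sum>b<r. complex_of_real (p b) * (\<Sum>j\<in>A. X b j $$ (u,v)))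
        = (\<Sum>j\<in>A. \<Sum>b<r. complex_of_real (p b * t b j) * (V j * adj (V j)) $$ (u,v))"
      unfolding sum_distrib_left by (subst sum.swap) (simp add: X_nth[OF uv] mult.assoc del: index_mult_mat)
    also have "\<dots> = (\<Sum>j\<in>A. complex_of_real q * (V j * adj (V j)) $$ (u,v))"
    proof (rule sum.cong[OF refl])
      fix j assume "j \<in> A"
      hence j: "j < J" using A by auto
      have "(\<Sum>b<r. complex_of_real (p b * t b j) * (V j * adj (V j)) $$ (u,v))
          = complex_of_real (c j) * (V j * adj (V j)) $$ (u,v)"
        by (simp only: ct of_real_sum sum_distrib_right)
      also have "\<dots> = complex_of_real q * (V j * adj (V j)) $$ (u,v)"
      \<comment> \<open>The walk fixes the mean weight of nonzero pieces only; for a zero piece the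
        outer product vanishes, so its weight does not matter.\<close>
      proof (cases "V j = 0\<^sub>m d 1")
        case True
        have "V j * adj (V j) = 0\<^sub>m d d"
          using left_mult_zero_mat[of "adj (V j)" 1 d d] V(1)[of j] unfolding True by simp
        thus ?thesis using uv by simp
      qed (simp add: c j)
      finally show "(\<Sum>b<r. complex_of_real (p b * t b j) * (V j * adj (V j)) $$ (u,v))
          = complex_of_real q * (V j * adj (V j)) $$ (u,v)" .
    qed
    finally show ?thesis by (simp only: sum_distrib_left)
  qed
  have N_carrier: "N b i \<in> carrier_mat d d" for b i
    by (auto simp: N_def intro!: minus_carrier_mat)
  have "msum d (\<lambda>b. complex_of_real (p b) \<cdot>\<^sub>m N b i) {..<r} = postsel d n q M i" if "i \<le> n" for i
  proof (rule eq_matI)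
    have Mi: "i < n \<Longrightarrow> M i \<in> carrier_mat d d" using V(2) by simp
    hence pc: "postsel d n q M i \<in> carrier_mat d d" by (auto simp: postsel_def)
    thus "dim_row (msum d (\<lambda>b. complex_of_real (p b) \<cdot>\<^sub>m N b i) {..<r}) = dim_row (postsel d n q M i)"
      "dim_col (msum d (\<lambda>b. complex_of_real (p b) \<cdot>\<^sub>m N b i) {..<r}) = dim_col (postsel d n q M i)" by auto
    fix u v assume "u < dim_row (postsel d n q M i)" "v < dim_col (postsel d n q M i)"
    hence uv: "u < d" "v < d" using pc by auto
    have L: "msum d (\<lambda>b. complex_of_real (p b) \<cdot>\<^sub>m N b i) {..<r} $$ (u,v)
        = (\<Sum>b<r. complex_of_real (p b) * N b i $$ (u,v))"
      unfolding index_msum[OF uv]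
      by (intro sum.cong refl index_smult_mat) (simp_all add: carrier_matD[OF N_carrier] uv)
    show "msum d (\<lambda>b. complex_of_real (p b) \<cdot>\<^sub>m N b i) {..<r} $$ (u,v) = postsel d n q M i $$ (u,v)"
    proof (cases "i < n")
      case True
      have "(\<Sum>b<r. complex_of_real (p b) * N b i $$ (u,v))
          = complex_of_real q * (\<Sum>j | j < J \<and> j div d = i. (V j * adj (V j)) $$ (u,v))"
        using avg[OF uv, of "{j. j < J \<and> j div d = i}"] True uv by (auto simp: N_def simp del: index_mult_mat)
      also have "\<dots> = complex_of_real q * M i $$ (u,v)"
        using V(2)[OF True] uv by (simp del: index_mult_mat)
      finally show ?thesis using L True Mi uv by (simp add: postsel_def)
    next
      case False
      have "(\<Sum>b<r. complex_of_real (p b) * N b i $$ (u,v))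
          = (\<Sum>b<r. complex_of_real (p b) * 1\<^sub>m d $$ (u,v) - complex_of_real (p b) * (\<Sum>j<J. X b j $$ (u,v)))"
        using False uv by (simp add: N_def right_diff_distrib)
      also have "\<dots> = complex_of_real (\<Sum>b<r. p b) * 1\<^sub>m d $$ (u,v)
          - complex_of_real q * (\<Sum>j<J. (V j * adj (V j)) $$ (u,v))"
        unfolding sum_subtractf avg[OF uv order_refl] by (simp only: of_real_sum sum_distrib_right)
      also have "(\<Sum>j<J. (V j * adj (V j)) $$ (u,v)) = 1\<^sub>m d $$ (u,v)"
        using arg_cong[OF V(3), of "\<lambda>A. A $$ (u,v)"] unfolding index_msum[OF uv] .
      also have "(\<Sum>b<r. p b) = 1" using p by (simp add: prob_dist_def)
      finally show ?thesis using L False uv by (simp add: postsel_def left_diff_distrib)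
    qed
  qed
  moreover have "povm d (Suc n) (N b)" "implementable d (Suc \<kappa>) (Suc n) (N b)"
    "card {i. i \<le> n \<and> N b i \<noteq> 0\<^sub>m d d} \<le> d * \<kappa> + 1" if "b < r" for b
    using sparse_weights_simulation[of J V d "\<lambda>j. j div d" n "t b" \<kappa>, OF V(1) lab t[OF that]]
    unfolding N_def[abs_def] X_def[abs_def] by blast+
  ultimately show ?thesis using p by (intro exI[of _ r] exI[of _ p] exI[of _ N]) blast
qed

text \<open>With \<open>s = sqrt k\<close>, the expansion
  \<open>(s - 2) (1 + s)\<^sup>2 = s\<^sup>3 - 3 s - 2\<close> bounds the rate below by
  \<open>1 - 2 / s\<close>. Passing to the ancilla dimension \<open>k + 1\<close> turns 2 into 3,
  because \<open>4 (k + 1) \<le> 9 k\<close> for \<open>k \<ge> 1\<close>.\<close>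

lemma sampling_rate_bound:
  assumes "k \<ge> 1"
  shows "real k / (1 + sqrt (real k))\<^sup>2 \<ge> 1 - 3 / sqrt (real (Suc k))"
proof -
  define s where "s = sqrt (real k)"
  define u where "u = sqrt (real (Suc k))"
  have s: "s \<ge> 1" "s\<^sup>2 = real k" using assms by (auto simp: s_def)
  have u: "u > 0" "u\<^sup>2 = s\<^sup>2 + 1" by (auto simp: u_def s(2))
  have "(2 * u)\<^sup>2 \<le> (3 * s)\<^sup>2"
    using assms unfolding power_mult_distrib u(2) s(2) by simp
  hence us: "2 * u \<le> 3 * s" by (rule power2_le_imp_le) (use s(1) in linarith)
  have "1 - 3 / u \<le> 1 - 2 / s" using us u(1) s(1) by (simp add: field_simps)
  also have "\<dots> \<le> s\<^sup>2 / (1 + s)\<^sup>2"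
  proof -
    have "(s - 2) * (1 + s)\<^sup>2 \<le> s ^ 3" using s(1) by (simp add: power2_eq_square power3_eq_cube algebra_simps)
    hence "(s - 2) / s \<le> s\<^sup>2 / (1 + s)\<^sup>2"
      using s(1) by (simp add: frac_le_eq divide_le_0_iff power2_eq_square power3_eq_cube mult_ac)
    thus ?thesis using s(1) by (simp add: diff_divide_distrib)
  qed
  finally show ?thesis by (simp add: s_def u_def)
qed

theorem theorem5:
  shows "(\<exists>K::real. K > 0 \<and>
           (\<forall>d k n M. d \<ge> 1 \<longrightarrow> k \<ge> 2 \<longrightarrow> povm d n M \<longrightarrow>
              (\<exists>r p N q. prob_dist r p \<and>
                 (\<forall>b<r. povm d (Suc n) (N b) \<and> implementable d k (Suc n) (N b)) \<and>
                 (\<forall>i\<le>n. msum d (\<lambda>b. complex_of_real (p b) \<cdot>\<^sub>m N b i) {..<r} = postsel d n q M i) \<and>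
                 q \<ge> 1 - K / sqrt (real k))))
       \<and>
         (\<forall>d n M. d \<ge> 1 \<longrightarrow> povm d n M \<longrightarrow>
              (\<exists>r p N q. prob_dist r p \<and>
                 (\<forall>b<r. povm d (Suc n) (N b) \<and> implementable d 2 (Suc n) (N b) \<and>
                        card {i. i \<le> n \<and> N b i \<noteq> 0\<^sub>m d d} \<le> d + 1) \<and>
                 (\<forall>i\<le>n. msum d (\<lambda>b. complex_of_real (p b) \<cdot>\<^sub>m N b i) {..<r} = postsel d n q M i) \<and>
                 q \<ge> 1 / 8))"
proof (rule conjI)
  show "\<exists>K::real. K > 0 \<and>
           (\<forall>d k n M. d \<ge> 1 \<longrightarrow> k \<ge> 2 \<longrightarrow> povm d n M \<longrightarrow>
              (\<exists>r p N q. prob_dist r p \<and>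
                 (\<forall>b<r. povm d (Suc n) (N b) \<and> implementable d k (Suc n) (N b)) \<and>
                 (\<forall>i\<le>n. msum d (\<lambda>b. complex_of_real (p b) \<cdot>\<^sub>m N b i) {..<r} = postsel d n q M i) \<and>
                 q \<ge> 1 - K / sqrt (real k)))"
  proof (rule exI[of _ 3], intro conjI allI impI)
    fix d k n :: nat and M
    assume d: "d \<ge> 1" and k: "k \<ge> 2" and M: "povm d n M"
    \<comment> \<open>One level of the ancilla is reserved for the input state;
      \<open>\<kappa>\<close> counts the others.\<close>
    obtain \<kappa> where \<kappa>: "k = Suc \<kappa>" "\<kappa> \<ge> 1" using k by (cases k) auto
    define q where "q = real \<kappa> / (1 + sqrt (real \<kappa>))\<^sup>2"
    obtain r p N where "prob_dist r p"
      "\<forall>b<r. povm d (Suc n) (N b) \<and> implementable d k (Suc n) (N b)"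
      "\<forall>i\<le>n. msum d (\<lambda>b. complex_of_real (p b) \<cdot>\<^sub>m N b i) {..<r} = postsel d n q M i"
      using povm_postselected_simulation[OF d \<kappa>(2) M, folded q_def] unfolding \<kappa>(1) by blast
    moreover have "q \<ge> 1 - 3 / sqrt (real k)"
      using sampling_rate_bound[OF \<kappa>(2)] unfolding q_def \<kappa>(1) .
    ultimately show "\<exists>r p N q. prob_dist r p \<and>
                 (\<forall>b<r. povm d (Suc n) (N b) \<and> implementable d k (Suc n) (N b)) \<and>
                 (\<forall>i\<le>n. msum d (\<lambda>b. complex_of_real (p b) \<cdot>\<^sub>m N b i) {..<r} = postsel d n q M i) \<and>
                 q \<ge> 1 - 3 / sqrt (real k)"
      by (intro exI[of _ r] exI[of _ p] exI[of _ N] exI[of _ q]) simp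
  qed simp
  show "\<forall>d n M. d \<ge> 1 \<longrightarrow> povm d n M \<longrightarrow>
              (\<exists>r p N q. prob_dist r p \<and>
                 (\<forall>b<r. povm d (Suc n) (N b) \<and> implementable d 2 (Suc n) (N b) \<and>
                        card {i. i \<le> n \<and> N b i \<noteq> 0\<^sub>m d d} \<le> d + 1) \<and>
                 (\<forall>i\<le>n. msum d (\<lambda>b. complex_of_real (p b) \<cdot>\<^sub>m N b i) {..<r} = postsel d n q M i) \<and>
                 q \<ge> 1 / 8)"
  proof (intro allI impI)
    fix d n :: nat and M
    assume "d \<ge> 1" "povm d n M"
    \<comment> \<open>The case \<open>\<kappa> = 1\<close>: the rate is
      \<open>1 / (1 + 1)\<^sup>2 = 1 / 4\<close>, better than the required
      \<open>1 / 8\<close>.\<close>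
    from povm_postselected_simulation[OF this(1) order_refl this(2)] obtain r p N where
      "prob_dist r p"
      "\<forall>b<r. povm d (Suc n) (N b) \<and> implementable d (Suc 1) (Suc n) (N b) \<and>
            card {i. i \<le> n \<and> N b i \<noteq> 0\<^sub>m d d} \<le> d * 1 + 1"
      "\<forall>i\<le>n. msum d (\<lambda>b. complex_of_real (p b) \<cdot>\<^sub>m N b i) {..<r}
         = postsel d n (real 1 / (1 + sqrt (real 1))\<^sup>2) M i"
      by blast
    thus "\<exists>r p N q. prob_dist r p \<and>
                 (\<forall>b<r. povm d (Suc n) (N b) \<and> implementable d 2 (Suc n) (N b) \<and>
                        card {i. i \<le> n \<and> N b i \<noteq> 0\<^sub>m d d} \<le> d + 1) \<and>
                 (\<forall>i\<le>n. msum d (\<lambda>b. complex_of_real (p b) \<cdot>\<^sub>m N b i) {..<r} = postsel d n q M i) \<and>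
                 q \<ge> 1 / 8"
      by (intro exI[of _ r] exI[of _ p] exI[of _ N] exI[of _ "real 1 / (1 + sqrt (real 1))\<^sup>2"])
         (simp_all add: numeral_2_eq_2)
  qed
qed

end
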